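(* Let $\xi$ be an extremal real number. Then there exist constants $c>0$ and $t>0$ such that, for any rational number $\alpha\in\mathbb{Q}$, we have $$|\xi-\alpha|\ge c\,H(\alpha)^{-2}(1+\log H(\alpha))^{-t}.$$
   Context: A real number $\xi$ is called extremal if it is neither rational nor quadratic irrational (i.e. not algebraic over $\mathbb{Q}$ of degree at most $2$) and there exists a constant $c'>0$ such that, for every real number $X\ge 1$, the inequalities $|x_0|\le X$, $|x_0\xi-x_1|\le c'X^{-1/\gamma}$, $|x_0\xi^2-x_2|\le c'X^{-1/\gamma}$ have a non-zero solution $(x_0,x_1,x_2)\in\mathbb{Z}^3$, where $\gamma=(1+\sqrt5)/2$. The height $H(P)$ of a polynomial $P\in\mathbb{R}[T]$ is the maximum of the absolute values of its coefficients, and the height $H(\alpha)$ of an algebraic number $\alpha$ is the height of its irreducible polynomial over $\mathbb{Z}$ (primitive integer polynomial, irreducible over $\mathbb Q$, having $\alpha$ as a root). For $\alpha=p/q$ in lowest terms, $H(\alpha)=\max(|p|,|q|)$. *)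

theory Defs
  imports "HOL-Analysis.Analysis" "HOL-Computational_Algebra.Polynomial_Factorial"
begin

definition golden_ratio :: real where
  "golden_ratio = (1 + sqrt 5) / 2"

definition algebraic_degree_le :: "nat \<Rightarrow> real \<Rightarrow> bool" where
  "algebraic_degree_le n x \<longleftrightarrow>
     (\<exists>P :: rat poly. P \<noteq> 0 \<and> degree P \<le> n \<and> poly (map_poly of_rat P) x = 0)"

definition extremal :: "real \<Rightarrow> bool" where
  "extremal \<xi> \<longleftrightarrow>
     \<not> algebraic_degree_le 2 \<xi> \<and>
     (\<exists>c'>0. \<forall>X::real. X \<ge> 1 \<longrightarrow>
        (\<exists>x0 x1 x2 :: int. (x0, x1, x2) \<noteq> (0, 0, 0) \<and>
           \<bar>of_int x0\<bar> \<le> X \<and>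
           \<bar>of_int x0 * \<xi> - of_int x1\<bar> \<le> c' * X powr (- 1 / golden_ratio) \<and>
           \<bar>of_int x0 * \<xi>\<^sup>2 - of_int x2\<bar> \<le> c' * X powr (- 1 / golden_ratio)))"

definition poly_height :: "real poly \<Rightarrow> real" where
  "poly_height P = Max {\<bar>coeff P i\<bar> |i. i \<le> degree P}"

definition is_irreducible_poly_of :: "int poly \<Rightarrow> 'a :: field_char_0 \<Rightarrow> bool" where
  "is_irreducible_poly_of P \<alpha> \<longleftrightarrow>
     Polynomial.content P = 1 \<and> irreducible (map_poly rat_of_int P) \<and> poly (map_poly of_int P) \<alpha> = 0"

(* The irreducible polynomial is only determined up to sign, so the description operator
   picks the common height rather than the polynomial.  Unspecified if \<alpha> is not algebraic. *)
definition alg_height :: "'a :: field_char_0 \<Rightarrow> real" where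
  "alg_height \<alpha> =
     (THE h. \<exists>P. is_irreducible_poly_of P \<alpha> \<and> h = poly_height (map_poly of_int P))"

lemma poly_height_linear:
  assumes "m \<noteq> 0"
  shows "poly_height [:b, m:] = max \<bar>b\<bar> \<bar>m\<bar>"
proof -
  have "{\<bar>coeff [:b, m:] i\<bar> |i. i \<le> degree [:b, m:]} = {\<bar>b\<bar>, \<bar>m\<bar>}"
    using assms by (auto simp: le_Suc_eq intro: exI[of _ 0] exI[of _ 1])
  then show ?thesis by (simp add: poly_height_def)
qed

lemma is_irreducible_poly_of_rational_iff:
  fixes p q :: int
  assumes "coprime p q" "q > 0"
  shows "is_irreducible_poly_of P (of_int p / of_int q :: 'a :: field_char_0)
           \<longleftrightarrow> P = [:- p, q:] \<or> P = [:p, - q:]"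
proof
  assume "P = [:- p, q:] \<or> P = [:p, - q:]"
  moreover have "irreducible [:a, b:]" if "b \<noteq> 0" for a b :: rat
    using that by (intro irreducible_linear_field_poly) auto
  moreover have "gcd p q = 1" using assms by simp
  ultimately show "is_irreducible_poly_of P (of_int p / of_int q :: 'a)"
    using assms by (auto simp: is_irreducible_poly_of_def map_poly_pCons content_def)
next
  define a :: rat where "a = of_int p / of_int q"
  assume P: "is_irreducible_poly_of P (of_int p / of_int q :: 'a)"
  define Q where "Q = map_poly rat_of_int P"
  have P': "content P = 1" "irreducible Q" and r: "poly (map_poly of_int P) (of_rat a :: 'a) = 0"
    using P by (auto simp: is_irreducible_poly_of_def Q_def a_def of_rat_divide)
  have dQ: "degree Q = degree P" unfolding Q_def by (rule degree_map_poly) auto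
  have "poly (map_poly of_int P) (of_rat a :: 'a) = of_rat (poly Q a)"
    by (auto simp: poly_altdef Q_def coeff_map_poly degree_map_poly of_rat_sum of_rat_mult of_rat_power)
  with r have "poly Q a = 0" by simp
  then obtain S where S: "Q = [:- a, 1:] * S" by (auto simp: poly_eq_0_iff_dvd)
  with P' have u: "S dvd 1"
    by (metis degree_pCons_eq_if irreducibleD is_unit_iff_degree pCons_eq_0_iff zero_neq_one nat.distinct(1))
  then have "S \<noteq> 0" by auto
  then have "degree P = 1"
    using u S dQ degree_mult_eq[of "[:- a, 1:]" S] is_unit_iff_degree[of S] by auto
  then obtain b m where bm: "P = [:b, m:]" "m \<noteq> 0"
    by (metis degree1_coeffs)
  have "poly Q a = of_int (b * q + m * p) / of_int q"
    using bm \<open>q > 0\<close> by (simp add: Q_def a_def map_poly_pCons field_simps)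
  with \<open>poly Q a = 0\<close> \<open>q > 0\<close> have "(of_int (b * q + m * p) :: rat) = 0" by simp
  then have e: "b * q = - (m * p)" by linarith
  have c: "coprime b m" using P' bm by (simp add: content_def coprime_iff_gcd_eq_1)
  have "q dvd m" using e assms
    by (metis coprime_commute coprime_dvd_mult_left_iff dvd_minus_iff dvd_triv_right)
  moreover have "m dvd q" using e c
    by (metis coprime_commute coprime_dvd_mult_right_iff dvd_minus_iff dvd_triv_left)
  ultimately have "\<bar>m\<bar> = \<bar>q\<bar>" by (rule zdvd_antisym_abs[rotated])
  then consider "m = q" | "m = - q" by linarith
  then show "P = [:- p, q:] \<or> P = [:p, - q:]"
  proof cases
    case 1
    with e have "(b + p) * q = 0" by (simp add: algebra_simps)
    with \<open>q > 0\<close> bm 1 show ?thesis by (simp add: eq_neg_iff_add_eq_0)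
  next
    case 2
    with e have "(b - p) * q = 0" by (simp add: algebra_simps)
    with \<open>q > 0\<close> bm 2 show ?thesis by simp
  qed
qed

lemma alg_height_rational:
  fixes p q :: int
  assumes "coprime p q" "q > 0"
  shows "alg_height (of_int p / of_int q :: 'a :: field_char_0) = of_int (max \<bar>p\<bar> \<bar>q\<bar>)"
  unfolding alg_height_def is_irreducible_poly_of_rational_iff[OF assms]
  using assms by (intro the_equality) (auto simp: map_poly_pCons poly_height_linear)

end

theory Submission
  imports Defs
begin

text \<open>
Write \<open>X\<close> for the first coordinate of an integer point \<open>(X, P, Q)\<close> and let \<open>L\<close> be the larger of
\<open>\<bar>X * \<xi> - P\<bar>\<close> and \<open>\<bar>X * \<xi>\<^sup>2 - Q\<bar>\<close>. The proof rests on a sequence of such points with \<open>L\<close> of the order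
of \<open>1 / X\<close>, with \<open>X * Q \<noteq> P\<^sup>2\<close>, and with \<open>ln X\<close> multiplied by the golden ratio at each step up to a
bounded error. The golden ratio satisfies \<open>g\<^sup>2 = g + 1\<close>, so the sizes \<open>X\<close> of three consecutive points
obey the Fibonacci rule: the third is the product of the first two up to a bounded factor
(\<open>approximation_sequence\<close>).

The points are found among the minimal points of \<open>(1, \<xi>, \<xi>\<^sup>2)\<close>, following Davenport and Schmidt.
Extremality bounds \<open>L\<close> from above in terms of the next minimal point. In the other direction two
determinants are nonzero integers: \<open>X * Q - P\<^sup>2\<close>, for all large indices, and the determinant of three
consecutive minimal points, for infinitely many indices because \<open>1, \<xi>, \<xi>\<^sup>2\<close> are linearly independent
over the rationals. At the indices of the second kind these inequalities are tight up to constants.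
Between two such indices the minimal points stay in one plane, and the fact that consecutive minimal
points form a basis of the lattice of that plane controls the growth of \<open>X\<close>.

View a point as the symmetric matrix with rows \<open>(X, P)\<close> and \<open>(P, Q)\<close>. The matrices of the sequence
have bounded nonzero determinants and nearly kill the direction of \<open>(\<xi>, - 1)\<close>, while their adjugates
nearly kill \<open>(1, \<xi>)\<close>. Let \<open>p / q\<close> be close to \<open>\<xi>\<close>, and apply to the vector \<open>(p, - q)\<close> the matrix of
index \<open>k + 1\<close> and then the adjugate of the one of index \<open>k\<close>. The result is again a nonzero integer
vector \<open>(p', - q')\<close>. It is shorter by a factor of the order of \<open>X\<^sub>k\<^sub>+\<^sub>1 / X\<^sub>k\<close>, and \<open>\<bar>q * \<xi> - p\<bar>\<close> has
grown by at most about the same factor. So a lower bound for the product of height and linear form at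
\<open>(p', q')\<close> implies one at \<open>(p, q)\<close> that is weaker by a bounded factor only. In this way a lower bound
\<open>c\<close> at the sizes \<open>X\<^sub>k\<^sub>-\<^sub>1\<close> and \<open>X\<^sub>k\<close> becomes a lower bound \<open>c / D\<close> at the size \<open>X\<^sub>k\<^sub>+\<^sub>1\<close>, with a constant
\<open>D\<close> (\<open>gap_up_to_step\<close>). Since \<open>ln X\<^sub>k\<close> grows exponentially in \<open>k\<close>, a rational of height \<open>H\<close> is
reached after \<open>O(ln (ln H))\<close> steps, and the accumulated loss is at most a constant times a power of
\<open>1 + ln H\<close> (\<open>logarithmic_bound_from_gaps\<close>).
\<close>

section \<open>The golden ratio\<close>

lemma golden_ratio_square: "golden_ratio\<^sup>2 = golden_ratio + 1"
  by (simp add: golden_ratio_def power2_eq_square field_simps)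

lemma golden_ratio_bounds: "3 / 2 < golden_ratio" "golden_ratio < 17 / 10"
proof -
  have "2 < sqrt 5" by (rule real_less_rsqrt) simp
  moreover have "sqrt 5 < 24 / 10" by (rule real_less_lsqrt) (simp_all add: power2_eq_square)
  ultimately show "3 / 2 < golden_ratio" "golden_ratio < 17 / 10" by (simp_all add: golden_ratio_def)
qed

text \<open>In the application \<open>a1, a2\<close> are the logarithms of the sizes of two consecutive minimal points, and
\<open>l0, l1\<close> are the logarithms of the approximation errors of the point before the first one and of the
first one. The last four hypotheses then express extremality (twice) and the nonvanishing of the two
determinants. As \<open>g * (g - 1) = 1\<close> and \<open>(g + 1) * (2 - g) = 1\<close>, the upper and lower bounds that they
imply for \<open>a2\<close> have the same leading term.\<close>

lemma golden_estimates:
  fixes a1 a2 l0 l1 C :: real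
  defines "g \<equiv> golden_ratio"
  assumes C: "0 \<le> C"
    and up0: "l0 \<le> C + (1 - g) * a1" and up1: "l1 \<le> C + (1 - g) * a2"
    and low1: "0 \<le> C + a1 + l1" and low01: "0 \<le> C + a2 + l1 + l0"
  shows "a2 \<le> g * a1 + 4 * C" "g * a1 - 9 * C \<le> a2" "l1 \<le> 8 * C - a1" "- ((g - 1) * a1) - 4 * C \<le> l0"
proof -
  have g: "g * g = g + 1" "3 / 2 < g" "g < 17 / 10"
    using golden_ratio_square golden_ratio_bounds by (simp_all add: g_def power2_eq_square)
  have gC: "g * C \<le> 17 / 10 * C" using g C by (intro mult_right_mono) auto
  have "g * ((g - 1) * a2) \<le> g * (a1 + 2 * C)"
    using up1 low1 g by (intro mult_left_mono) (simp_all add: algebra_simps)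
  moreover have "g * ((g - 1) * a2) = a2" using g(1) by algebra
  ultimately show 1: "a2 \<le> g * a1 + 4 * C" using gC C by (simp add: algebra_simps)
  have "(g + 1) * ((g - 1) * a1) \<le> (g + 1) * ((2 - g) * a2 + 3 * C)"
    using up0 up1 low01 g by (intro mult_left_mono) (simp_all add: algebra_simps)
  moreover have "(g + 1) * ((g - 1) * a1) = g * a1" using g(1) by algebra
  moreover have "(g + 1) * ((2 - g) * a2 + 3 * C) = a2 + 3 * (g * C) + 3 * C" using g(1) by algebra
  ultimately show 2: "g * a1 - 9 * C \<le> a2" using gC C by linarith
  have "(g - 1) * (g * a1 - 9 * C) \<le> (g - 1) * a2" using 2 g by (intro mult_left_mono) auto
  moreover have "(g - 1) * (g * a1 - 9 * C) = a1 - 9 * (g * C) + 9 * C" using g(1) by algebra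
  ultimately show "l1 \<le> 8 * C - a1" using up1 gC C by (simp add: algebra_simps)
  have "(2 - g) * a2 \<le> (2 - g) * (g * a1 + 4 * C)" using 1 g by (intro mult_left_mono) auto
  moreover have "(2 - g) * (g * a1 + 4 * C) = (g - 1) * a1 + 8 * C - 4 * (g * C)" using g(1) by algebra
  moreover have "3 / 2 * C \<le> g * C" using g C by (intro mult_right_mono) auto
  moreover have "(2 - g) * a2 = a2 + (1 - g) * a2" by (simp add: algebra_simps)
  ultimately show "- ((g - 1) * a1) - 4 * C \<le> l0" using up1 low01 by linarith
qed

section \<open>Transferring a lower bound between heights\<close>

text \<open>The range of heights is cut off at \<open>sqrt c * Y\<close> rather than at \<open>Y\<close>. For a vector of height \<open>h\<close>, an
approximating point of size \<open>Y\<close> produces an error of the order of \<open>h\<^sup>2 / Y\<^sup>2\<close>, and with this cutoff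
the error remains of the order of \<open>c\<close> while \<open>c\<close> shrinks from step to step.\<close>

definition gap_up_to :: "real \<Rightarrow> real \<Rightarrow> real \<Rightarrow> bool" where
  "gap_up_to \<xi> c Y \<longleftrightarrow>
     (\<forall>p q :: int. (p, q) \<noteq> (0, 0) \<longrightarrow> (of_int (max \<bar>p\<bar> \<bar>q\<bar>))\<^sup>2 \<le> c * Y\<^sup>2 \<longrightarrow>
        c \<le> of_int (max \<bar>p\<bar> \<bar>q\<bar>) * \<bar>of_int q * \<xi> - of_int p\<bar>)"

lemma gap_up_to_mono:
  assumes "gap_up_to \<xi> c Y" "c' \<le> c"
  shows "gap_up_to \<xi> c' Y"
  unfolding gap_up_to_def
proof (intro allI impI)
  fix p q :: int
  assume pq: "(p, q) \<noteq> (0, 0)" and h: "(of_int (max \<bar>p\<bar> \<bar>q\<bar>))\<^sup>2 \<le> c' * Y\<^sup>2"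
  have "c' * Y\<^sup>2 \<le> c * Y\<^sup>2" using assms(2) by (intro mult_right_mono) auto
  with h have "(of_int (max \<bar>p\<bar> \<bar>q\<bar>))\<^sup>2 \<le> c * Y\<^sup>2" by linarith
  with assms(1) pq have "c \<le> of_int (max \<bar>p\<bar> \<bar>q\<bar>) * \<bar>of_int q * \<xi> - of_int p\<bar>"
    unfolding gap_up_to_def by blast
  with assms(2) show "c' \<le> of_int (max \<bar>p\<bar> \<bar>q\<bar>) * \<bar>of_int q * \<xi> - of_int p\<bar>" by linarith
qed

lemma max_abs_ge_1:
  assumes "(p, q) \<noteq> (0 :: int, 0 :: int)"
  shows "1 \<le> real_of_int (max \<bar>p\<bar> \<bar>q\<bar>)"
proof -
  have "1 \<le> max \<bar>p\<bar> \<bar>q\<bar>" using assms by auto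
  then show ?thesis by linarith
qed

text \<open>Vacuous, as every nonzero integer vector has height at least 1; this starts the induction.\<close>

lemma gap_up_to_trivial:
  assumes "c * Y\<^sup>2 < 1"
  shows "gap_up_to \<xi> c Y"
  unfolding gap_up_to_def
proof (intro allI impI)
  fix p q :: int
  assume pq: "(p, q) \<noteq> (0, 0)" and h: "(of_int (max \<bar>p\<bar> \<bar>q\<bar>))\<^sup>2 \<le> c * Y\<^sup>2"
  have "1 \<le> (real_of_int (max \<bar>p\<bar> \<bar>q\<bar>))\<^sup>2"
    using max_abs_ge_1[OF pq] by (rule one_le_power)
  with h assms show "c \<le> of_int (max \<bar>p\<bar> \<bar>q\<bar>) * \<bar>of_int q * \<xi> - of_int p\<bar>" by linarith
qed

lemma abs_mult_le:
  fixes x y :: real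
  assumes "\<bar>x\<bar> \<le> a" "\<bar>y\<bar> \<le> b"
  shows "\<bar>x * y\<bar> \<le> a * b"
  using mult_mono[OF assms] by (auto simp: abs_mult intro: order_trans[OF abs_ge_zero assms(1)])

text \<open>Here \<open>(v1, v2)\<close> is the image of \<open>(p, - q)\<close> under the matrix of the point
\<open>(n, n * \<xi> + a, n * \<xi>\<^sup>2 + b)\<close>, and \<open>(u1, u2)\<close> is the image of \<open>(v1, v2)\<close> under the adjugate of the
matrix of \<open>(m, m * \<xi> + a', m * \<xi>\<^sup>2 + b')\<close>. Both are written so that the large terms cancel visibly:
\<open>(v1, v2)\<close> is close to a multiple of \<open>(1, \<xi>)\<close>, which the adjugate nearly kills. The last expression
is \<open>m * (u1 + \<xi> * u2)\<close>, and its first factor is the determinant of the second matrix.\<close>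

lemma transfer_size:
  fixes \<xi> K m n a b a' b' p q h l :: real
  assumes K: "1 \<le> K" "\<bar>\<xi>\<bar> \<le> K" and m: "1 \<le> m" and n: "1 \<le> n"
    and ab: "\<bar>a\<bar> \<le> K / n" "\<bar>b\<bar> \<le> K / n" and ab': "\<bar>a'\<bar> \<le> K / m" "\<bar>b'\<bar> \<le> K / m"
    and h: "\<bar>p\<bar> \<le> h" "\<bar>q\<bar> \<le> h" and l: "\<bar>p - \<xi> * q\<bar> \<le> l"
    and v1: "v1 = n * (p - \<xi> * q) - a * q"
    and v2: "v2 = n * \<xi> * (p - \<xi> * q) + a * p - b * q"
    and u1: "u1 = m * \<xi> * (\<xi> * v1 - v2) + b' * v1 - a' * v2"
    and u2: "u2 = m * (v2 - \<xi> * v1) - a' * v1"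
  shows "\<bar>u1\<bar> \<le> 6 * K^3 * (m * h / n) + 2 * K^2 * (n * l / m)"
    and "\<bar>u2\<bar> \<le> 6 * K^3 * (m * h / n) + 2 * K^2 * (n * l / m)"
    and "\<bar>(m * b' - 2 * m * \<xi> * a' - a'^2) * v1 - a' * u2\<bar> \<le> 5 * K^2 * (n * l) + 8 * K^3 * (h / n)"
proof -
  have pos: "0 \<le> h" "0 \<le> l" "0 < K" using h l K by linarith+
  define s where "s = p - \<xi> * q"
  define H where "H = K * h / n"
  have H0: "0 \<le> H" using pos n by (simp add: H_def)
  have t: "\<bar>a * q\<bar> \<le> H" "\<bar>a * p\<bar> \<le> H" "\<bar>b * q\<bar> \<le> H"
    using abs_mult_le[OF ab(1) h(2)] abs_mult_le[OF ab(1) h(1)] abs_mult_le[OF ab(2) h(2)]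
    by (simp_all add: H_def)
  have t4: "\<bar>\<xi> * (a * q)\<bar> \<le> K * H" using abs_mult_le[OF K(2) t(1)] .
  have ns: "\<bar>n * s\<bar> \<le> n * l"
    using l n by (intro abs_mult_le) (auto simp: s_def)
  have nxs: "\<bar>\<xi> * (n * s)\<bar> \<le> K * (n * l)" using abs_mult_le[OF K(2) ns] .
  have bv1: "\<bar>v1\<bar> \<le> n * l + H" using v1 t ns unfolding s_def by linarith
  have "v2 = \<xi> * (n * s) + a * p - b * q" by (simp add: v2 s_def)
  then have bv2: "\<bar>v2\<bar> \<le> K * (n * l) + 2 * H" using t nxs by linarith
  have "v2 - \<xi> * v1 = a * p - b * q + \<xi> * (a * q)" by (simp add: v1 v2 algebra_simps)
  then have "\<bar>v2 - \<xi> * v1\<bar> \<le> 2 * H + K * H" using t t4 by linarith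
  moreover have "H \<le> K * H" using K H0 by (simp add: mult_le_cancel_right1)
  ultimately have bd: "\<bar>v2 - \<xi> * v1\<bar> \<le> 3 * (K * H)" by linarith
  have md: "\<bar>m * (v2 - \<xi> * v1)\<bar> \<le> m * (3 * (K * H))"
    using bd m by (intro abs_mult_le) auto
  have xmd: "\<bar>\<xi> * (m * (v2 - \<xi> * v1))\<bar> \<le> K * (m * (3 * (K * H)))"
    using abs_mult_le[OF K(2) md] .
  have bb: "\<bar>b' * v1\<bar> \<le> K / m * (n * l + H)" "\<bar>a' * v1\<bar> \<le> K / m * (n * l + H)"
    "\<bar>a' * v2\<bar> \<le> K / m * (K * (n * l) + 2 * H)"
    using abs_mult_le[OF ab'(2) bv1] abs_mult_le[OF ab'(1) bv1] abs_mult_le[OF ab'(1) bv2] by auto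
  have "K / m \<le> K" "K \<le> K * m" using m pos by (simp_all add: field_simps)
  then have Km: "K / m \<le> K * m" "0 \<le> K / m" using m pos by (linarith, simp)
  have KmH: "K / m * H \<le> K * m * H" by (intro mult_right_mono Km H0)
  have mHK: "K * m * H \<le> K * (m * (K * H))"
    using mult_right_mono[OF K(1), of "K * m * H"] pos m H0 by (simp add: mult_ac)
  have nl: "0 \<le> K / m * (n * l)" using Km(2) n pos by (intro mult_nonneg_nonneg) auto
  have KKnl: "K / m * (n * l) \<le> K * (K / m * (n * l))"
    using mult_right_mono[OF K(1) nl] by (simp only: mult_1_left)
  have KK: "m * (K * H) \<le> K * (m * (K * H))"
    using mult_right_mono[OF K(1), of "m * (K * H)"] pos m H0 by (simp add: mult_ac)
  have absorb1: "3 * A + 3 * B + C + D \<le> 6 * A + 2 * D" if "B \<le> E" "E \<le> A" "C \<le> D" for A B C D E :: real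
    using that by linarith
  have absorb2: "3 * F + C + B \<le> 6 * A + 2 * D"
    if "B \<le> E" "E \<le> A" "C \<le> D" "F \<le> A" "0 \<le> C" "0 \<le> A" for A B C D E F :: real
    using that by linarith
  have e1: "6 * K^3 * (m * h / n) + 2 * K^2 * (n * l / m) = 6 * (K * (m * (K * H))) + 2 * (K * (K / m * (n * l)))"
    by (simp add: H_def power2_eq_square power3_eq_cube mult_ac)
  have "\<xi> * (m * (v2 - \<xi> * v1)) = - (m * \<xi> * (\<xi> * v1 - v2))" by (simp add: algebra_simps)
  then have "\<bar>u1\<bar> \<le> K * (m * (3 * (K * H))) + K / m * (n * l + H) + K / m * (K * (n * l) + 2 * H)"
    using u1 xmd bb by linarith
  also have "\<dots> = 3 * (K * (m * (K * H))) + 3 * (K / m * H) + K / m * (n * l) + K * (K / m * (n * l))"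
    by (simp add: algebra_simps)
  also have "\<dots> \<le> 6 * (K * (m * (K * H))) + 2 * (K * (K / m * (n * l)))"
    by (rule absorb1[OF KmH mHK KKnl])
  finally show "\<bar>u1\<bar> \<le> 6 * K^3 * (m * h / n) + 2 * K^2 * (n * l / m)" using e1 by linarith
  have u2b: "\<bar>u2\<bar> \<le> m * (3 * (K * H)) + K / m * (n * l + H)"
    using u2 md bb by linarith
  also have "\<dots> = 3 * (m * (K * H)) + K / m * (n * l) + K / m * H" by (simp add: algebra_simps)
  also have "\<dots> \<le> 6 * (K * (m * (K * H))) + 2 * (K * (K / m * (n * l)))"
    by (rule absorb2[OF KmH mHK KKnl KK nl])
       (use K m H0 in \<open>intro mult_nonneg_nonneg; linarith\<close>)
  finally show "\<bar>u2\<bar> \<le> 6 * K^3 * (m * h / n) + 2 * K^2 * (n * l / m)" using e1 by linarith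
  have ma: "\<bar>m * b'\<bar> \<le> K" "\<bar>m * a'\<bar> \<le> K"
    using abs_mult_le[of m m, OF _ ab'(2)] abs_mult_le[of m m, OF _ ab'(1)] m by auto
  have "\<bar>\<xi> * (m * a')\<bar> \<le> K * K" using abs_mult_le[OF K(2) ma(2)] .
  moreover have "\<bar>a'\<bar> \<le> K" using ab'(1) m pos by (smt (verit) divide_le_eq_1 divide_right_mono div_by_1 frac_le)
  then have "\<bar>a' * a'\<bar> \<le> K * K" by (intro abs_mult_le) auto
  moreover have "K \<le> K * K" using K by simp
  moreover have "m * b' - 2 * m * \<xi> * a' - a'^2 = m * b' - 2 * (\<xi> * (m * a')) - a' * a'"
    by (simp add: power2_eq_square)
  ultimately have dt: "\<bar>m * b' - 2 * m * \<xi> * a' - a'^2\<bar> \<le> 4 * (K * K)" using ma by linarith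
  have d1: "\<bar>(m * b' - 2 * m * \<xi> * a' - a'^2) * v1\<bar> \<le> 4 * (K * K) * (n * l + H)"
    by (rule abs_mult_le[OF dt bv1])
  have d2: "\<bar>a' * u2\<bar> \<le> K / m * (m * (3 * (K * H)) + K / m * (n * l + H))"
    by (rule abs_mult_le[OF ab'(1) u2b])
  have "K / m * (m * (3 * (K * H)) + K / m * (n * l + H)) = 3 * (K * K * H) + (K / m) * (K / m) * (n * l + H)"
    using m by (simp add: field_simps)
  moreover have "K / m \<le> K" using m pos by (simp add: field_simps)
  then have "(K / m) * (K / m) * (n * l + H) \<le> (K * K) * (n * l + H)"
    using Km pos n H0 by (intro mult_right_mono mult_mono) auto
  ultimately have "\<bar>(m * b' - 2 * m * \<xi> * a' - a'^2) * v1 - a' * u2\<bar>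
       \<le> 5 * (K * K) * (n * l + H) + 3 * (K * K * H)"
    using d1 d2 by linarith
  also have "\<dots> = 5 * K^2 * (n * l) + 8 * K^3 * (h / n)"
    by (simp add: H_def power2_eq_square power3_eq_cube algebra_simps)
  finally show "\<bar>(m * b' - 2 * m * \<xi> * a' - a'^2) * v1 - a' * u2\<bar> \<le> 5 * K^2 * (n * l) + 8 * K^3 * (h / n)" .
qed

text \<open>Let \<open>h\<close> be the height of \<open>(p, q)\<close> and \<open>l = \<bar>q * \<xi> - p\<bar>\<close>. If \<open>l\<close> is at least \<open>h / R\<^sup>2\<close>, the bound at
level \<open>R\<close> suffices: heights beyond its range satisfy \<open>h * l \<ge> h\<^sup>2 / R\<^sup>2 > c\<close>. Otherwise the image
of \<open>(p, - q)\<close> described above is a nonzero integer vector whose height is \<open>O(h / R)\<close>, which brings it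
within the range of the bound at level \<open>m\<close>, and that bound carries back to \<open>(p, q)\<close>.\<close>

lemma gap_up_to_step:
  fixes \<xi> K R c :: real and m y1 y2 n z1 z2 :: int
  assumes K: "1 \<le> K" "\<bar>\<xi>\<bar> \<le> K"
    and m: "0 < m" and n: "0 < n" and R: "0 < R"
    and y: "\<bar>of_int m * \<xi> - of_int y1\<bar> \<le> K / of_int m" "\<bar>of_int m * \<xi>\<^sup>2 - of_int y2\<bar> \<le> K / of_int m"
    and z: "\<bar>of_int n * \<xi> - of_int z1\<bar> \<le> K / of_int n" "\<bar>of_int n * \<xi>\<^sup>2 - of_int z2\<bar> \<le> K / of_int n"
    and dy: "m * y2 \<noteq> y1\<^sup>2" and dz: "n * z2 \<noteq> z1\<^sup>2"
    and nmR: "of_int n \<le> K * of_int m * R" "of_int m * R \<le> K * of_int n"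
    and c: "0 < c" and gm: "gap_up_to \<xi> c (of_int m)" and gR: "gap_up_to \<xi> c R"
  shows "gap_up_to \<xi> (c / (128 * K ^ 10)) (of_int n)"
  unfolding gap_up_to_def
proof (intro allI impI)
  fix p q :: int
  define h where "h = max \<bar>p\<bar> \<bar>q\<bar>"
  define l where "l = \<bar>of_int q * \<xi> - of_int p\<bar>"
  \<comment> \<open>Squaring the height factor \<open>8 * K^4\<close> and replacing \<open>n / R\<close> by \<open>K * m\<close> costs \<open>64 * K^10\<close>; the
     doubling keeps the error term below half of \<open>c\<close>.\<close>
  define d where "d = c / (128 * K ^ 10)"
  assume pq: "(p, q) \<noteq> (0, 0)" and "(of_int (max \<bar>p\<bar> \<bar>q\<bar>))\<^sup>2 \<le> c / (128 * K ^ 10) * (of_int n)\<^sup>2"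
  then have hd: "(of_int h)\<^sup>2 \<le> d * (of_int n)\<^sup>2" by (simp add: h_def d_def)
  have K0: "0 < K" using K by simp
  have Kge: "1 \<le> K ^ j" for j using K by simp
  have dc: "c = 128 * K^10 * d" using K0 by (simp add: d_def)
  have d0: "0 < d" using c K0 by (simp add: d_def)
  have dlec: "d \<le> c" using d0 Kge[of 10] unfolding dc by (simp add: mult_le_cancel_right1)
  have h1: "1 \<le> real_of_int h" using max_abs_ge_1[OF pq] by (simp add: h_def)
  have l0: "0 \<le> l" by (simp add: l_def)
  let ?m = "real_of_int m" and ?n = "real_of_int n" and ?h = "real_of_int h"
  have m1: "1 \<le> ?m" "1 \<le> ?n" using m n by linarith+
  have "d \<le> ?h * l"
  proof (cases "?h \<le> l * R\<^sup>2")
    case True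
    show ?thesis
    proof (cases "?h\<^sup>2 \<le> c * R\<^sup>2")
      case True
      with gR pq have "c \<le> ?h * l" unfolding gap_up_to_def h_def l_def by blast
      with dlec show ?thesis by linarith
    next
      case False
      then have "c * R\<^sup>2 < ?h * ?h" by (simp add: power2_eq_square)
      also have "\<dots> \<le> ?h * (l * R\<^sup>2)" using True h1 by (intro mult_left_mono) auto
      finally have "c < ?h * l" using R by (simp add: mult.assoc[symmetric])
      with dlec show ?thesis by linarith
    qed
  next
    case False
    define v1 v2 where "v1 = n * p - z1 * q" and "v2 = z1 * p - z2 * q"
    define u1 u2 where "u1 = y2 * v1 - y1 * v2" and "u2 = m * v2 - y1 * v1"
    define a b a' b' where "a = of_int z1 - ?n * \<xi>" and "b = of_int z2 - ?n * \<xi>\<^sup>2"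
      and "a' = of_int y1 - ?m * \<xi>" and "b' = of_int y2 - ?m * \<xi>\<^sup>2"
    have zs: "real_of_int z1 = ?n * \<xi> + a" "real_of_int z2 = ?n * \<xi>\<^sup>2 + b"
      "real_of_int y1 = ?m * \<xi> + a'" "real_of_int y2 = ?m * \<xi>\<^sup>2 + b'"
      by (simp_all add: a_def b_def a'_def b'_def)
    have rv1: "real_of_int v1 = ?n * (of_int p - \<xi> * of_int q) - a * of_int q"
      by (simp add: v1_def zs algebra_simps)
    have rv2: "real_of_int v2 = ?n * \<xi> * (of_int p - \<xi> * of_int q) + a * of_int p - b * of_int q"
      by (simp add: v2_def zs algebra_simps power2_eq_square)
    have ru1: "real_of_int u1 = ?m * \<xi> * (\<xi> * of_int v1 - of_int v2) + b' * of_int v1 - a' * of_int v2"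
      by (simp add: u1_def zs algebra_simps power2_eq_square)
    have ru2: "real_of_int u2 = ?m * (of_int v2 - \<xi> * of_int v1) - a' * of_int v1"
      by (simp add: u2_def zs algebra_simps power2_eq_square)
    have ab: "\<bar>a\<bar> \<le> K / ?n" "\<bar>b\<bar> \<le> K / ?n" "\<bar>a'\<bar> \<le> K / ?m" "\<bar>b'\<bar> \<le> K / ?m"
      using y z by (simp_all add: a_def b_def a'_def b'_def abs_minus_commute)
    have ph: "\<bar>real_of_int p\<bar> \<le> ?h" "\<bar>real_of_int q\<bar> \<le> ?h" by (auto simp: h_def)
    have pl: "\<bar>of_int p - \<xi> * of_int q\<bar> \<le> l" by (simp add: l_def mult.commute abs_minus_commute)
    note size = transfer_size[OF K m1 ab ph pl rv1 rv2 ru1 ru2]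
    define h' where "h' = real_of_int (max \<bar>u1\<bar> \<bar>- u2\<bar>)"
    define l' where "l' = \<bar>of_int (- u2) * \<xi> - of_int u1\<bar>"
    \<comment> \<open>The product of a matrix and its adjugate is the nonzero determinant, so the image is nonzero.\<close>
    have "m * u1 + y1 * u2 = (m * y2 - y1\<^sup>2) * v1" "y1 * u1 + y2 * u2 = (m * y2 - y1\<^sup>2) * v2"
      by (simp_all add: u1_def u2_def algebra_simps power2_eq_square)
    moreover have "z1 * v1 - n * v2 = (n * z2 - z1\<^sup>2) * q" "z2 * v1 - z1 * v2 = (n * z2 - z1\<^sup>2) * p"
      by (simp_all add: v1_def v2_def algebra_simps power2_eq_square)
    ultimately have u: "(u1, - u2) \<noteq> (0, 0)" using dy dz pq by auto
    \<comment> \<open>The two contributions to the height of the image are both of the order of \<open>h / R\<close>.\<close>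
    have lR: "l * R\<^sup>2 \<le> ?h" using False by linarith
    have b1: "?m * ?h / ?n \<le> K * (?h / R)"
      using mult_right_mono[OF nmR(2), of ?h] h1 m1 R by (simp add: field_simps)
    have "?n * l \<le> K * ?m * R * l" using nmR(1) l0 by (intro mult_right_mono)
    then have "?n * l * R \<le> K * ?m * R * l * R" using R by (simp only: mult_right_mono less_imp_le)
    also have "\<dots> = K * ?m * (l * R\<^sup>2)" by (simp add: power2_eq_square)
    also have "\<dots> \<le> K * ?m * ?h" using lR K0 m1 by (intro mult_left_mono) auto
    finally have b2: "?n * l / ?m \<le> K * (?h / R)" using m1 R by (simp add: field_simps)
    have "h' \<le> 6 * K^3 * (?m * ?h / ?n) + 2 * K^2 * (?n * l / ?m)"
      using size(1,2) by (simp add: h'_def of_int_max)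
    also have "\<dots> \<le> 6 * K^3 * (K * (?h / R)) + 2 * K^2 * (K * (?h / R))"
      using b1 b2 K0 by (intro add_mono mult_left_mono) auto
    also have "\<dots> = 6 * (K^4 * (?h / R)) + 2 * (K^3 * (?h / R))" by (simp add: power_numeral_reduce)
    also have "K^3 * (?h / R) \<le> K^4 * (?h / R)"
      using K h1 R by (intro mult_right_mono power_increasing) auto
    finally have h': "h' \<le> 8 * K^4 * ?h / R" by (simp add: mult_ac)
    have h'0: "0 \<le> h'" by (simp add: h'_def)
    have "?m * l' = \<bar>(?m * b' - 2 * ?m * \<xi> * a' - a'^2) * of_int v1 - a' * of_int u2\<bar>"
    proof -
      have "\<bar>?m\<bar> = ?m" using m1 by linarith
      then have "?m * l' = \<bar>?m * (of_int u1 + \<xi> * of_int u2)\<bar>"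
        unfolding abs_mult l'_def by (simp add: abs_minus_commute mult.commute add.commute)
      also have "?m * (of_int u1 + \<xi> * of_int u2) = (?m * b' - 2 * ?m * \<xi> * a' - a'^2) * of_int v1 - a' * of_int u2"
        by (simp add: ru1 ru2 algebra_simps power2_eq_square)
      finally show ?thesis .
    qed
    with size(3) have l': "?m * l' \<le> 5 * K^2 * (?n * l) + 8 * K^3 * (?h / ?n)" by simp
    have nR: "?n / R \<le> K * ?m" using nmR R by (simp add: field_simps)
    have "h'\<^sup>2 \<le> (8 * K^4 * ?h / R)\<^sup>2" using h' h'0 by (intro power_mono)
    also have "\<dots> = 64 * K^8 * ?h\<^sup>2 / R\<^sup>2" by (simp add: power_mult_distrib power_divide flip: power_mult)
    also have "\<dots> \<le> 64 * K^8 * (d * ?n\<^sup>2) / R\<^sup>2"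
      using hd K0 by (intro divide_right_mono mult_left_mono) auto
    also have "\<dots> = 64 * K^8 * d * (?n / R)\<^sup>2" by (simp add: power_divide)
    also have "\<dots> \<le> 64 * K^8 * d * (K * ?m)\<^sup>2"
      using nR K0 d0 m1 R by (intro mult_left_mono power_mono) auto
    also have "\<dots> = c / 2 * ?m\<^sup>2" by (simp add: dc power_mult_distrib power_numeral_reduce)
    also have "\<dots> \<le> c * ?m\<^sup>2" using c by (intro mult_right_mono) auto
    finally have "c \<le> h' * l'" using gm u unfolding gap_up_to_def h'_def l'_def by blast
    then have "?m * c \<le> h' * (?m * l')" using m1 by (simp add: mult_left_mono)
    also have "\<dots> \<le> (8 * K^4 * ?h / R) * (5 * K^2 * (?n * l) + 8 * K^3 * (?h / ?n))"
      using h' h'0 l' m1 K0 R h1 by (intro mult_mono) (auto simp: l'_def)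
    also have "\<dots> = 40 * K^6 * (?h * l) * (?n / R) + 64 * K^7 * (?h\<^sup>2 / ?n\<^sup>2) * (?n / R)"
    proof -
      have 1: "(8 * K^4 * ?h / R) * (5 * K^2 * (?n * l) + 8 * K^3 * x)
          = 40 * K^6 * (?h * l) * (?n / R) + 64 * K^7 * (?h * x * (1 / R))" for x
        using R by (simp add: field_simps power_numeral_reduce)
      have 2: "64 * K^7 * (?h * (?h / ?n) * (1 / R)) = 64 * K^7 * (?h\<^sup>2 / ?n\<^sup>2) * (?n / R)"
        using m1 by (simp add: power2_eq_square)
      show ?thesis by (simp only: 1 2)
    qed
    also have "\<dots> \<le> 40 * K^6 * (?h * l) * (K * ?m) + 64 * K^7 * d * (K * ?m)"
    proof -
      have "?h\<^sup>2 / ?n\<^sup>2 \<le> d" using hd m1 by (simp add: field_simps)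
      then show ?thesis using nR K0 h1 l0 m1 R d0
        by (intro add_mono mult_mono mult_nonneg_nonneg) auto
    qed
    also have "\<dots> = ?m * (40 * K^7 * (?h * l) + 64 * K^8 * d)"
      by (simp add: algebra_simps power_numeral_reduce)
    finally have "c \<le> 40 * K^7 * (?h * l) + 64 * K^8 * d" using m1 by simp
    moreover have "K^8 * d \<le> K^10 * d" "K^7 * (?h * l) \<le> K^10 * (?h * l)"
      using K d0 h1 l0 by (auto intro!: mult_right_mono power_increasing)
    ultimately have "K^10 * (64 * d) \<le> K^10 * (40 * (?h * l))" unfolding dc by (simp add: algebra_simps)
    then have "64 * d \<le> 40 * (?h * l)" using K0 by (simp add: mult_le_cancel_left_pos)
    then show ?thesis using d0 h1 l0 by linarith
  qed
  then show "c / (128 * K ^ 10) \<le> of_int (max \<bar>p\<bar> \<bar>q\<bar>) * \<bar>of_int q * \<xi> - of_int p\<bar>"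
    by (simp add: d_def h_def l_def)
qed

section \<open>Integer points and planes\<close>

lemma integer_conic_parametrization:
  fixes x y z :: int
  assumes "x \<noteq> 0" "x * z = y\<^sup>2"
  obtains h m n where "x = h * m\<^sup>2" "y = h * m * n" "z = h * n\<^sup>2"
proof -
  obtain m n where mn: "x = gcd x y * m" "y = gcd x y * n" "coprime m n"
    using gcd_coprime_exists[of x y] assms(1) by (auto simp: mult.commute)
  define g where "g = gcd x y"
  have g: "g \<noteq> 0" "x = g * m" "y = g * n" "m \<noteq> 0" using assms(1) mn by (auto simp: g_def)
  have "g * (m * z) = g * (g * n\<^sup>2)" using assms(2) g by (simp add: power2_eq_square algebra_simps)
  then have mz: "m * z = g * n\<^sup>2" using g by simp
  then have "m dvd g * n\<^sup>2" by (metis dvd_triv_left)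
  moreover have "coprime m (n\<^sup>2)" using mn by simp
  ultimately have "m dvd g" using coprime_dvd_mult_left_iff by blast
  then obtain h where h: "g = m * h" by blast
  have "m * z = m * (h * n\<^sup>2)" using mz h by simp
  then have "z = h * n\<^sup>2" using g by simp
  then show ?thesis using that[of h m n] g h by (simp add: power2_eq_square mult_ac)
qed

text \<open>Cramer's rule, with a nonzero minor of \<open>y\<close> and \<open>z\<close> as common denominator.\<close>

lemma integer_plane_combination:
  fixes v0 v1 v2 y0 y1 y2 z0 z1 z2 :: int
  assumes det: "v0 * (y1 * z2 - y2 * z1) - v1 * (y0 * z2 - y2 * z0) + v2 * (y0 * z1 - y1 * z0) = 0"
    and np: "y0 * z1 \<noteq> z0 * y1 \<or> y0 * z2 \<noteq> z0 * y2"
  obtains d a b where "d \<noteq> 0" "d * v0 = a * y0 + b * z0" "d * v1 = a * y1 + b * z1" "d * v2 = a * y2 + b * z2"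
  using np
proof
  assume np: "y0 * z1 \<noteq> z0 * y1"
  show ?thesis
  proof (rule that)
    show "y0 * z1 - z0 * y1 \<noteq> 0" using np by simp
    show "(y0 * z1 - z0 * y1) * v0 = (v0 * z1 - z0 * v1) * y0 + (y0 * v1 - v0 * y1) * z0"
      "(y0 * z1 - z0 * y1) * v1 = (v0 * z1 - z0 * v1) * y1 + (y0 * v1 - v0 * y1) * z1" by algebra+
    show "(y0 * z1 - z0 * y1) * v2 = (v0 * z1 - z0 * v1) * y2 + (y0 * v1 - v0 * y1) * z2"
      using det by algebra
  qed
next
  assume np: "y0 * z2 \<noteq> z0 * y2"
  show ?thesis
  proof (rule that)
    show "y0 * z2 - z0 * y2 \<noteq> 0" using np by simp
    show "(y0 * z2 - z0 * y2) * v0 = (v0 * z2 - z0 * v2) * y0 + (y0 * v2 - v0 * y2) * z0"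
      "(y0 * z2 - z0 * y2) * v2 = (v0 * z2 - z0 * v2) * y2 + (y0 * v2 - v0 * y2) * z2" by algebra+
    show "(y0 * z2 - z0 * y2) * v1 = (v0 * z2 - z0 * v2) * y1 + (y0 * v2 - v0 * y2) * z1"
      using det by algebra
  qed
qed

section \<open>Minimal points\<close>

text \<open>The exponent \<open>1 - golden_ratio\<close> equals \<open>- 1 / golden_ratio\<close>.\<close>

locale extremal_number =
  fixes \<xi> c' :: real
  assumes nonquadratic: "\<And>a b c :: int. of_int a + of_int b * \<xi> + of_int c * \<xi>\<^sup>2 = 0 \<Longrightarrow> a = 0 \<and> b = 0 \<and> c = 0"
    and c'_pos: "0 < c'"
    and approximable: "\<And>X::real. 1 \<le> X \<Longrightarrow>
        (\<exists>x0 x1 x2 :: int. (x0, x1, x2) \<noteq> (0, 0, 0) \<and> \<bar>of_int x0\<bar> \<le> X \<and>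
           \<bar>of_int x0 * \<xi> - of_int x1\<bar> \<le> c' * X powr (1 - golden_ratio) \<and>
           \<bar>of_int x0 * \<xi>\<^sup>2 - of_int x2\<bar> \<le> c' * X powr (1 - golden_ratio))"
begin

definition err :: "nat \<Rightarrow> real" where
  "err n = max \<bar>real n * \<xi> - of_int (round (real n * \<xi>))\<bar> \<bar>real n * \<xi>\<^sup>2 - of_int (round (real n * \<xi>\<^sup>2))\<bar>"

lemma err_le:
  assumes "\<bar>real n * \<xi> - of_int y\<bar> \<le> e" "\<bar>real n * \<xi>\<^sup>2 - of_int z\<bar> \<le> e"
  shows "err n \<le> e"
  unfolding err_def
  using assms round_diff_minimal[of "real n * \<xi>" y] round_diff_minimal[of "real n * \<xi>\<^sup>2" z] by linarith

lemma err_le_half: "err n \<le> 1 / 2"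
  unfolding err_def using of_int_round_abs_le[of "real n * \<xi>"] of_int_round_abs_le[of "real n * \<xi>\<^sup>2"]
  by (simp add: abs_minus_commute)

lemma err_pos:
  assumes "0 < n"
  shows "0 < err n"
proof (rule ccontr)
  assume "\<not> 0 < err n"
  then have "real n * \<xi> - of_int (round (real n * \<xi>)) = 0" unfolding err_def by linarith
  then have "of_int (- round (real n * \<xi>)) + of_int (int n) * \<xi> + of_int 0 * \<xi>\<^sup>2 = 0" by simp
  from nonquadratic[OF this] assms show False by simp
qed

text \<open>Points may be compared through their first coordinate alone: if the error is below 1, that
coordinate is nonzero, and up to sign the best choice of the others is given by rounding.\<close>

lemma err_integer_point_le:
  fixes x0 x1 x2 :: int
  assumes nz: "(x0, x1, x2) \<noteq> (0, 0, 0)"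
    and le: "\<bar>of_int x0 * \<xi> - of_int x1\<bar> \<le> e" "\<bar>of_int x0 * \<xi>\<^sup>2 - of_int x2\<bar> \<le> e" and "e < 1"
  shows "x0 \<noteq> 0" "err (nat \<bar>x0\<bar>) \<le> e"
proof -
  show nz0: "x0 \<noteq> 0"
  proof
    assume "x0 = 0"
    with le \<open>e < 1\<close> have "\<bar>real_of_int x1\<bar> < 1" "\<bar>real_of_int x2\<bar> < 1" by simp_all
    then have "x1 = 0" "x2 = 0" by linarith+
    with nz \<open>x0 = 0\<close> show False by simp
  qed
  show "err (nat \<bar>x0\<bar>) \<le> e"
  proof (cases "0 \<le> x0")
    case True
    with le show ?thesis by (intro err_le[of _ x1 _ x2]) auto
  next
    case False
    with le show ?thesis by (intro err_le[of _ "- x1" _ "- x2"]) auto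
  qed
qed

lemma powr_neg_tendsto_0:
  assumes "e < 0"
  shows "((\<lambda>x::real. M * x powr e) \<longlongrightarrow> 0) at_top"
  using tendsto_mult_right_zero[OF tendsto_neg_powr[OF assms filterlim_ident], of M] by simp

lemma err_arbitrarily_small:
  assumes "0 < e"
  shows "\<exists>n>0. err n < e"
proof -
  have "\<forall>\<^sub>F x in at_top. c' * x powr (1 - golden_ratio) < min e 1"
    using golden_ratio_bounds assms by (intro order_tendstoD(2)[OF powr_neg_tendsto_0]) auto
  from eventually_happens'[OF _ eventually_conj[OF eventually_ge_at_top[of 1] this]]
  obtain X where X: "1 \<le> X" "c' * X powr (1 - golden_ratio) < min e 1" by auto
  from approximable[OF X(1)] obtain x0 x1 x2 :: int where x: "(x0, x1, x2) \<noteq> (0, 0, 0)"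
    "\<bar>of_int x0 * \<xi> - of_int x1\<bar> \<le> c' * X powr (1 - golden_ratio)"
    "\<bar>of_int x0 * \<xi>\<^sup>2 - of_int x2\<bar> \<le> c' * X powr (1 - golden_ratio)" by blast
  from err_integer_point_le[OF x] X have "x0 \<noteq> 0" "err (nat \<bar>x0\<bar>) < e" by auto
  then show ?thesis by (intro exI[of _ "nat \<bar>x0\<bar>"]) auto
qed

text \<open>The successive record denominators of \<open>err\<close>, that is, the first coordinates of the minimal
points.\<close>

primrec den :: "nat \<Rightarrow> nat" where
  "den 0 = 1"
| "den (Suc i) = (LEAST n. 0 < n \<and> err n < err (den i))"

declare den.simps(2) [simp del]

abbreviation L :: "nat \<Rightarrow> real" where "L i \<equiv> err (den i)"

lemma den_pos: "0 < den i"
  and den_Suc_less: "L (Suc i) < L i"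
proof -
  have *: "0 < den (Suc i) \<and> L (Suc i) < L i" if "0 < den i" for i
    using LeastI_ex[OF err_arbitrarily_small[OF err_pos[OF that]]] by (simp only: den.simps(2))
  show 1: "0 < den i" for i
  proof (induction i)
    case (Suc i)
    then show ?case using *[of i] by blast
  qed simp
  show "L (Suc i) < L i" using * 1 by blast
qed

lemma den_minimal:
  assumes "0 < n" "n < den (Suc i)"
  shows "L i \<le> err n"
  using not_less_Least[of n "\<lambda>n. 0 < n \<and> err n < err (den i)"] assms by (auto simp: den.simps(2))

lemma den_less_Suc: "den i < den (Suc i)"
proof (cases i)
  case 0
  have "den (Suc 0) \<noteq> den 0" using den_Suc_less[of 0] by (metis less_irrefl)
  then show ?thesis using den_pos[of "Suc 0"] 0 by simp
next
  case (Suc j)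
  show ?thesis
  proof (rule ccontr)
    assume "\<not> den i < den (Suc i)"
    moreover have "den (Suc i) \<noteq> den i" using den_Suc_less[of i] by auto
    ultimately have "den (Suc i) < den i" by linarith
    then have "L j \<le> L (Suc (Suc j))" using den_minimal[OF den_pos] Suc by blast
    then show False using den_Suc_less[of j] den_Suc_less[of "Suc j"] Suc by linarith
  qed
qed

lemma strict_mono_den: "strict_mono den"
  by (simp add: strict_mono_Suc_iff den_less_Suc)

lemma L_pos: "0 < L i" by (rule err_pos[OF den_pos])

lemma filterlim_den: "filterlim (\<lambda>i. real (den i)) at_top sequentially"
  by (rule filterlim_compose[OF filterlim_real_sequentially filterlim_subseq[OF strict_mono_den]])

definition X :: "nat \<Rightarrow> int" where "X i = int (den i)"
definition P :: "nat \<Rightarrow> int" where "P i = round (real (den i) * \<xi>)"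
definition Q :: "nat \<Rightarrow> int" where "Q i = round (real (den i) * \<xi>\<^sup>2)"
definition \<alpha> :: "nat \<Rightarrow> real" where "\<alpha> i = of_int (X i) * \<xi> - of_int (P i)"
definition \<beta> :: "nat \<Rightarrow> real" where "\<beta> i = of_int (X i) * \<xi>\<^sup>2 - of_int (Q i)"

lemma of_int_P: "real_of_int (P i) = of_int (X i) * \<xi> - \<alpha> i"
  and of_int_Q: "real_of_int (Q i) = of_int (X i) * \<xi>\<^sup>2 - \<beta> i"
  by (simp_all add: \<alpha>_def \<beta>_def)

lemma L_eq: "L i = max \<bar>\<alpha> i\<bar> \<bar>\<beta> i\<bar>"
  by (simp add: err_def \<alpha>_def \<beta>_def X_def P_def Q_def)

lemma \<alpha>_le: "\<bar>\<alpha> i\<bar> \<le> L i" and \<beta>_le: "\<bar>\<beta> i\<bar> \<le> L i"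
  by (simp_all add: L_eq)

lemma X_pos: "0 < X i" and X_ge_1: "1 \<le> real_of_int (X i)" and X_less_Suc: "X i < X (Suc i)"
  using den_pos[of i] den_less_Suc[of i] by (auto simp: X_def)

lemma X_mono: "i \<le> j \<Longrightarrow> X i \<le> X j"
  using strict_mono_den by (simp add: X_def strict_mono_less_eq)

text \<open>Extremality is applied just below the next record denominator, where by minimality every
solution has error at least \<open>L i\<close>; the factor 2 pays for replacing \<open>N - 1\<close> by \<open>N\<close>.\<close>

lemma L_le_power: "L i \<le> 2 * c' * of_int (X (Suc i)) powr (1 - golden_ratio)"
proof -
  define N where "N = real (den (Suc i))"
  have N: "2 \<le> N" using den_pos[of i] den_less_Suc[of i] by (simp add: N_def)
  let ?e = "c' * (N - 1) powr (1 - golden_ratio)"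
  have "L i \<le> ?e"
  proof (cases "?e < 1")
    case True
    from N have "1 \<le> N - 1" by simp
    from approximable[OF this] obtain x0 x1 x2 :: int where x: "(x0, x1, x2) \<noteq> (0, 0, 0)"
      "\<bar>of_int x0 * \<xi> - of_int x1\<bar> \<le> ?e" "\<bar>of_int x0 * \<xi>\<^sup>2 - of_int x2\<bar> \<le> ?e"
      and x0: "\<bar>real_of_int x0\<bar> \<le> N - 1" by blast
    note e = err_integer_point_le[OF x True]
    have "L i \<le> err (nat \<bar>x0\<bar>)"
      using e(1) x0 by (intro den_minimal) (auto simp: N_def simp del: den.simps)
    with e(2) show ?thesis by linarith
  next
    case False
    with err_le_half[of "den i"] show ?thesis by linarith
  qed
  also have "?e \<le> c' * (N / 2) powr (1 - golden_ratio)"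
    using N c'_pos golden_ratio_bounds by (intro mult_left_mono powr_mono2') auto
  also have "(N / 2) powr (1 - golden_ratio) = N powr (1 - golden_ratio) * 2 powr (golden_ratio - 1)"
    using N by (simp add: powr_divide powr_diff field_simps)
  also have "c' * (N powr (1 - golden_ratio) * 2 powr (golden_ratio - 1)) \<le> c' * (N powr (1 - golden_ratio) * 2 powr 1)"
    using c'_pos golden_ratio_bounds by (intro mult_left_mono powr_mono) auto
  finally show ?thesis by (simp add: N_def X_def mult_ac)
qed

text \<open>Otherwise scaling would give \<open>X i * L (i + 1) = X (i + 1) * L i\<close>, whereas \<open>X\<close> increases and \<open>L\<close>
decreases.\<close>

lemma not_proportional:
  "X i * P (Suc i) \<noteq> X (Suc i) * P i \<or> X i * Q (Suc i) \<noteq> X (Suc i) * Q i"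
proof (rule ccontr)
  assume "\<not> ?thesis"
  then have "real_of_int (X i * P (Suc i)) = of_int (X (Suc i) * P i)"
     "real_of_int (X i * Q (Suc i)) = of_int (X (Suc i) * Q i)" by simp_all
  then have "of_int (X i) * \<alpha> (Suc i) = of_int (X (Suc i)) * \<alpha> i"
    "of_int (X i) * \<beta> (Suc i) = of_int (X (Suc i)) * \<beta> i"
    by (simp_all add: of_int_P of_int_Q algebra_simps)
  then have "of_int (X i) * \<bar>\<alpha> (Suc i)\<bar> = of_int (X (Suc i)) * \<bar>\<alpha> i\<bar>"
    "of_int (X i) * \<bar>\<beta> (Suc i)\<bar> = of_int (X (Suc i)) * \<bar>\<beta> i\<bar>"
    by (metis X_pos abs_mult abs_of_pos of_int_0_less_iff)+
  then have "of_int (X i) * L (Suc i) = of_int (X (Suc i)) * L i"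
    unfolding L_eq using X_ge_1[of i] X_ge_1[of "Suc i"] by (simp add: max_mult_distrib_left)
  moreover have "of_int (X i) * L (Suc i) < of_int (X (Suc i)) * L i"
    using X_ge_1[of i] X_less_Suc[of i] L_pos[of "Suc i"] den_Suc_less[of i]
    by (intro mult_strict_mono) auto
  ultimately show False by linarith
qed

lemma discriminant_bound:
  "\<bar>real_of_int (X i * Q i - (P i)\<^sup>2)\<bar> \<le> (2 + 2 * \<bar>\<xi>\<bar>) * of_int (X i) * L i"
proof -
  let ?x = "real_of_int (X i)"
  have eq: "real_of_int (X i * Q i - (P i)\<^sup>2) = - (?x * \<beta> i) + 2 * (\<xi> * (?x * \<alpha> i)) - \<alpha> i * \<alpha> i"
    by (simp add: of_int_P of_int_Q algebra_simps power2_eq_square)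
  have "\<bar>?x * \<alpha> i\<bar> \<le> ?x * L i" "\<bar>?x * \<beta> i\<bar> \<le> ?x * L i"
    using X_ge_1[of i] \<alpha>_le[of i] \<beta>_le[of i] by (simp_all add: abs_mult mult_left_mono)
  moreover from this have "\<bar>\<xi> * (?x * \<alpha> i)\<bar> \<le> \<bar>\<xi>\<bar> * (?x * L i)"
    by (simp only: abs_mult[of \<xi>] mult_left_mono abs_ge_zero)
  moreover have "\<bar>\<alpha> i\<bar> \<le> ?x" using \<alpha>_le[of i] err_le_half[of "den i"] X_ge_1[of i] by linarith
  then have "\<bar>\<alpha> i * \<alpha> i\<bar> \<le> ?x * L i" using abs_mult_le \<alpha>_le[of i] by blast
  moreover have "(2 + 2 * \<bar>\<xi>\<bar>) * ?x * L i = 2 * (?x * L i) + 2 * (\<bar>\<xi>\<bar> * (?x * L i))"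
    by (simp add: algebra_simps)
  ultimately show ?thesis unfolding eq by linarith
qed

text \<open>A point with vanishing determinant is \<open>h * (m\<^sup>2, m * n, n\<^sup>2)\<close>. Then \<open>m * P - n * X\<close> and \<open>m * Q - n * P\<close>,
evaluated at the preceding minimal point, are integers that do not both vanish, because the two
points are not proportional; they are bounded by a multiple of \<open>\<bar>m\<bar> * L i\<close>, and \<open>m\<^sup>2\<close> is at most
the size of the degenerate point.\<close>

lemma discriminant_zero_bound:
  assumes "X (Suc i) * Q (Suc i) = (P (Suc i))\<^sup>2"
  shows "1 \<le> (2 + 2 * \<bar>\<xi>\<bar>) * sqrt (of_int (X (Suc i))) * L i"
proof -
  let ?j = "Suc i"
  have "X ?j \<noteq> 0" using X_pos[of ?j] by simp
  from integer_conic_parametrization[OF this assms] obtain h m n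
    where hmn: "X ?j = h * m\<^sup>2" "P ?j = h * m * n" "Q ?j = h * n\<^sup>2" by metis
  have h0: "m \<noteq> 0" "0 < h" using X_pos[of ?j] by (auto simp: hmn zero_less_mult_iff)
  then have h1: "1 \<le> real_of_int h" by linarith
  let ?m = "real_of_int m" and ?n = "real_of_int n" and ?h = "real_of_int h"
  have "?m\<^sup>2 \<le> of_int (X ?j)" using h1 by (simp add: hmn mult_le_cancel_right1)
  then have m_le: "\<bar>?m\<bar> \<le> sqrt (of_int (X ?j))" by (simp add: real_le_rsqrt)
  define D1 D2 where "D1 = m * P i - n * X i" and "D2 = m * Q i - n * P i"
  define s where "s = ?m * \<xi> - ?n"
  have "\<alpha> ?j = (?h * ?m) * s" by (simp add: \<alpha>_def hmn s_def algebra_simps power2_eq_square)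
  then have hs: "?h * \<bar>?m\<bar> * \<bar>s\<bar> \<le> L i" using \<alpha>_le[of ?j] den_Suc_less[of i] h1 by (simp add: abs_mult)
  have "of_int (X i) * \<bar>s\<bar> \<le> of_int (X ?j) * \<bar>s\<bar>" using X_less_Suc[of i] by (intro mult_right_mono) auto
  also have "real_of_int (X ?j) = ?h * (\<bar>?m\<bar> * \<bar>?m\<bar>)" by (simp add: hmn power2_eq_square)
  also have "?h * (\<bar>?m\<bar> * \<bar>?m\<bar>) * \<bar>s\<bar> = \<bar>?m\<bar> * (?h * \<bar>?m\<bar> * \<bar>s\<bar>)" by (simp only: mult_ac)
  also have "\<dots> \<le> \<bar>?m\<bar> * L i" using hs by (intro mult_left_mono) auto
  finally have Xs: "\<bar>of_int (X i) * s\<bar> \<le> \<bar>?m\<bar> * L i" using X_ge_1[of i] by (simp add: abs_mult)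
  have ma: "\<bar>?m * \<alpha> i\<bar> \<le> \<bar>?m\<bar> * L i" "\<bar>?m * \<beta> i\<bar> \<le> \<bar>?m\<bar> * L i"
    using \<alpha>_le[of i] \<beta>_le[of i] by (simp_all add: abs_mult mult_left_mono)
  have xi: "\<bar>\<xi> * (of_int (X i) * s)\<bar> \<le> \<bar>\<xi>\<bar> * (\<bar>?m\<bar> * L i)"
    using Xs by (simp only: abs_mult[of \<xi>] mult_left_mono abs_ge_zero)
  have "\<bar>s\<bar> \<le> \<bar>?m\<bar>"
  proof -
    have "1 * \<bar>s\<bar> \<le> of_int (X i) * \<bar>s\<bar>" using X_ge_1[of i] by (intro mult_right_mono) auto
    also have "\<dots> \<le> \<bar>?m\<bar> * L i" using Xs X_ge_1[of i] by (simp add: abs_mult)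
    also have "\<dots> \<le> \<bar>?m\<bar> * 1" using err_le_half[of "den i"] by (intro mult_left_mono) auto
    finally show ?thesis by simp
  qed
  then have sa: "\<bar>s * \<alpha> i\<bar> \<le> \<bar>?m\<bar> * L i" using \<alpha>_le[of i] by (simp add: abs_mult mult_mono)
  have d1: "real_of_int D1 = of_int (X i) * s - ?m * \<alpha> i"
    by (simp add: D1_def of_int_P s_def algebra_simps)
  have d2: "real_of_int D2 = \<xi> * (of_int (X i) * s) - ?m * \<beta> i + ?n * \<alpha> i"
    by (simp add: D2_def of_int_P of_int_Q s_def algebra_simps power2_eq_square)
  have n: "?n * \<alpha> i = \<xi> * (?m * \<alpha> i) - s * \<alpha> i" by (simp add: s_def algebra_simps)
  have xm: "\<bar>\<xi> * (?m * \<alpha> i)\<bar> \<le> \<bar>\<xi>\<bar> * (\<bar>?m\<bar> * L i)"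
    using ma(1) by (simp only: abs_mult[of \<xi>] mult_left_mono abs_ge_zero)
  have "0 \<le> \<bar>\<xi>\<bar> * (\<bar>?m\<bar> * L i)" using L_pos[of i] by simp
  then have bound: "\<bar>real_of_int D1\<bar> \<le> 2 * (\<bar>?m\<bar> * L i) + 2 * (\<bar>\<xi>\<bar> * (\<bar>?m\<bar> * L i))"
    "\<bar>real_of_int D2\<bar> \<le> 2 * (\<bar>?m\<bar> * L i) + 2 * (\<bar>\<xi>\<bar> * (\<bar>?m\<bar> * L i))"
    using d1 d2 n Xs ma xi sa xm by linarith+
  have "D1 \<noteq> 0 \<or> D2 \<noteq> 0"
  proof (rule ccontr)
    assume "\<not> (D1 \<noteq> 0 \<or> D2 \<noteq> 0)"
    then have D: "m * P i = n * X i" "m * Q i = n * P i" by (simp_all add: D1_def D2_def)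
    have "X ?j * P i = h * m * (m * P i)" by (simp add: hmn power2_eq_square)
    also have "\<dots> = X i * P ?j" by (simp add: D hmn)
    finally have 1: "X i * P ?j = X ?j * P i" by simp
    have "X ?j * Q i = h * m * (m * Q i)" by (simp add: hmn power2_eq_square)
    also have "\<dots> = h * n * (m * P i)" by (simp add: D)
    also have "\<dots> = X i * Q ?j" by (simp add: D hmn power2_eq_square)
    finally show False using 1 not_proportional[of i] by simp
  qed
  then have "1 \<le> \<bar>D1\<bar> \<or> 1 \<le> \<bar>D2\<bar>" by linarith
  then have "1 \<le> \<bar>real_of_int D1\<bar> \<or> 1 \<le> \<bar>real_of_int D2\<bar>" by linarith
  with bound have "1 \<le> (2 + 2 * \<bar>\<xi>\<bar>) * (\<bar>?m\<bar> * L i)" by (auto simp: algebra_simps)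
  also have "\<dots> \<le> (2 + 2 * \<bar>\<xi>\<bar>) * (sqrt (of_int (X ?j)) * L i)"
    using m_le L_pos[of i] by (intro mult_left_mono mult_right_mono) auto
  finally show ?thesis by (simp add: mult.assoc)
qed

text \<open>The bound just obtained decays like \<open>X\<close> to the power \<open>3 / 2 - golden_ratio\<close>, which is negative.\<close>

lemma eventually_discriminant_nonzero: "\<forall>\<^sub>F i in sequentially. X i * Q i \<noteq> (P i)\<^sup>2"
proof -
  let ?M = "(2 + 2 * \<bar>\<xi>\<bar>) * (2 * c')"
  have "((\<lambda>i. ?M * real (den (Suc i)) powr (3 / 2 - golden_ratio)) \<longlongrightarrow> 0) sequentially"
    using golden_ratio_bounds
    by (intro filterlim_compose[OF powr_neg_tendsto_0 filterlim_compose[OF filterlim_den filterlim_Suc]]) auto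
  then have "\<forall>\<^sub>F i in sequentially. ?M * real (den (Suc i)) powr (3 / 2 - golden_ratio) < 1"
    by (rule order_tendstoD) simp
  then have "\<forall>\<^sub>F i in sequentially. X (Suc i) * Q (Suc i) \<noteq> (P (Suc i))\<^sup>2"
  proof (rule eventually_mono)
    fix i
    let ?x = "real_of_int (X (Suc i))"
    assume lt: "?M * real (den (Suc i)) powr (3 / 2 - golden_ratio) < 1"
    have "sqrt ?x * ?x powr (1 - golden_ratio) = ?x powr (3 / 2 - golden_ratio)"
      using X_ge_1[of "Suc i"] by (simp add: powr_half_sqrt[symmetric] powr_add[symmetric])
    moreover have "(2 + 2 * \<bar>\<xi>\<bar>) * sqrt ?x * (2 * c' * ?x powr (1 - golden_ratio))
        = ?M * (sqrt ?x * ?x powr (1 - golden_ratio))" by (simp only: mult_ac)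
    ultimately have "(2 + 2 * \<bar>\<xi>\<bar>) * sqrt ?x * (2 * c' * ?x powr (1 - golden_ratio)) < 1"
      using lt by (simp only: X_def of_int_of_nat_eq)
    moreover have "(2 + 2 * \<bar>\<xi>\<bar>) * sqrt ?x * L i \<le> (2 + 2 * \<bar>\<xi>\<bar>) * sqrt ?x * (2 * c' * ?x powr (1 - golden_ratio))"
      using L_le_power[of i] X_ge_1[of "Suc i"] by (intro mult_left_mono) auto
    ultimately show "X (Suc i) * Q (Suc i) \<noteq> (P (Suc i))\<^sup>2"
      using discriminant_zero_bound[of i] by linarith
  qed
  then show ?thesis by (rule eventually_sequentially_Suc[THEN iffD1])
qed

definition triple_det :: "nat \<Rightarrow> int" where
  "triple_det i =
     X i * (P (i+1) * Q (i+2) - Q (i+1) * P (i+2))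
   - P i * (X (i+1) * Q (i+2) - Q (i+1) * X (i+2))
   + Q i * (X (i+1) * P (i+2) - P (i+1) * X (i+2))"

lemma triple_det_bound:
  "\<bar>real_of_int (triple_det i)\<bar> \<le> 6 * (of_int (X (i+2)) * (L (i+1) * L i))"
proof -
  let ?x = "\<lambda>j. real_of_int (X j)"
  have eq: "real_of_int (triple_det i) =
      ?x i * (\<alpha> (i+1) * \<beta> (i+2)) - ?x i * (\<beta> (i+1) * \<alpha> (i+2))
    - ?x (i+1) * (\<alpha> i * \<beta> (i+2)) + ?x (i+2) * (\<alpha> i * \<beta> (i+1))
    + ?x (i+1) * (\<beta> i * \<alpha> (i+2)) - ?x (i+2) * (\<beta> i * \<alpha> (i+1))"
    unfolding triple_det_def of_int_add of_int_diff of_int_mult of_int_P of_int_Q by algebra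
  have L: "L (i+1) \<le> L i" "L (i+2) \<le> L (i+1)" "L (i+2) \<le> L i" "0 \<le> L (i+1)" "0 \<le> L i"
    using den_Suc_less[of i] den_Suc_less[of "Suc i"] L_pos[of "i+1"] L_pos[of i] by simp_all
  have X: "\<bar>?x i\<bar> \<le> ?x (i+2)" "\<bar>?x (i+1)\<bar> \<le> ?x (i+2)" "\<bar>?x (i+2)\<bar> \<le> ?x (i+2)"
    using X_mono[of i "i+2"] X_mono[of "i+1" "i+2"] X_pos[of i] X_pos[of "i+1"] X_pos[of "i+2"] by simp_all
  note ab = order_trans[OF \<alpha>_le] order_trans[OF \<beta>_le]
  have "\<bar>?x i * (\<alpha> (i+1) * \<beta> (i+2))\<bar> \<le> ?x (i+2) * (L (i+1) * L i)"
    "\<bar>?x i * (\<beta> (i+1) * \<alpha> (i+2))\<bar> \<le> ?x (i+2) * (L (i+1) * L i)"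
    by (intro abs_mult_le X ab L order_refl)+
  moreover have "\<bar>?x (i+1) * (\<beta> (i+2) * \<alpha> i)\<bar> \<le> ?x (i+2) * (L (i+1) * L i)"
    "\<bar>?x (i+2) * (\<beta> (i+1) * \<alpha> i)\<bar> \<le> ?x (i+2) * (L (i+1) * L i)"
    "\<bar>?x (i+1) * (\<alpha> (i+2) * \<beta> i)\<bar> \<le> ?x (i+2) * (L (i+1) * L i)"
    "\<bar>?x (i+2) * (\<alpha> (i+1) * \<beta> i)\<bar> \<le> ?x (i+2) * (L (i+1) * L i)"
    by (intro abs_mult_le X ab L order_refl)+
  ultimately show ?thesis unfolding eq mult.commute[of "\<alpha> i"] mult.commute[of "\<beta> i"] by linarith
qed

text \<open>If the triples were dependent from some index on, all later minimal points would lie in one plane.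
Dividing its equation by \<open>X i\<close> and letting \<open>i\<close> grow would give a rational linear relation between
\<open>1, \<xi>, \<xi>\<^sup>2\<close>.\<close>

lemma infinite_triple_det_nonzero: "infinite {i. triple_det i \<noteq> 0}"
proof
  assume "finite {i. triple_det i \<noteq> 0}"
  then obtain k where k: "\<And>i. triple_det i \<noteq> 0 \<Longrightarrow> i < k"
    using finite_nat_set_iff_bounded by auto
  define a b c where "a = P k * Q (Suc k) - Q k * P (Suc k)"
    and "b = Q k * X (Suc k) - X k * Q (Suc k)" and "c = X k * P (Suc k) - P k * X (Suc k)"
  have plane: "a * X i + b * P i + c * Q i = 0 \<and> a * X (Suc i) + b * P (Suc i) + c * Q (Suc i) = 0"
    if "k \<le> i" for i
    using that
  proof (induction i rule: dec_induct)
    case base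
    show ?case unfolding a_def b_def c_def by (intro conjI) algebra+
  next
    case (step i)
    have "triple_det i = 0" using k[of i] step.hyps by fastforce
    then have "X (i+2) * (P i * Q (Suc i) - Q i * P (Suc i)) - P (i+2) * (X i * Q (Suc i) - Q i * X (Suc i))
        + Q (i+2) * (X i * P (Suc i) - P i * X (Suc i)) = 0"
      unfolding triple_det_def Suc_eq_plus1 by algebra
    from integer_plane_combination[OF this not_proportional] obtain d r s where
      d: "d \<noteq> 0" "d * X (i+2) = r * X i + s * X (Suc i)" "d * P (i+2) = r * P i + s * P (Suc i)"
        "d * Q (i+2) = r * Q i + s * Q (Suc i)" .
    have "d * (a * X (i+2) + b * P (i+2) + c * Q (i+2)) = 0"
      using step.IH d(2-4) by algebra
    with d(1) step.IH show ?case by simp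
  qed
  define z where "z = real_of_int a + of_int b * \<xi> + of_int c * \<xi>\<^sup>2"
  have bound: "\<bar>z\<bar> \<le> (\<bar>of_int b\<bar> + \<bar>of_int c\<bar>) / real i" if "k \<le> i" "0 < i" for i
  proof -
    have "real_of_int (a * X i + b * P i + c * Q i) = 0" using plane[OF that(1)] by simp
    then have "z * of_int (X i) = of_int b * \<alpha> i + of_int c * \<beta> i"
      by (simp add: z_def of_int_P of_int_Q algebra_simps)
    moreover have "\<bar>of_int b * \<alpha> i\<bar> \<le> \<bar>of_int b\<bar> * 1" "\<bar>of_int c * \<beta> i\<bar> \<le> \<bar>of_int c\<bar> * 1"
      using \<alpha>_le[of i] \<beta>_le[of i] err_le_half[of "den i"] by (intro abs_mult_le; linarith)+
    ultimately have "\<bar>z * of_int (X i)\<bar> \<le> \<bar>of_int b\<bar> + \<bar>of_int c\<bar>" by linarith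
    then have "\<bar>z\<bar> * of_int (X i) \<le> \<bar>of_int b\<bar> + \<bar>of_int c\<bar>" using X_ge_1[of i] by (simp add: abs_mult)
    moreover have "real i \<le> of_int (X i)"
      using strict_mono_imp_increasing[OF strict_mono_den, of i] by (simp add: X_def)
    then have "\<bar>z\<bar> * real i \<le> \<bar>z\<bar> * of_int (X i)" by (intro mult_left_mono) auto
    ultimately show ?thesis using that(2) by (simp add: field_simps)
  qed
  have "((\<lambda>i. (\<bar>of_int b\<bar> + \<bar>of_int c\<bar>) / real i) \<longlongrightarrow> 0) sequentially" by (rule lim_const_over_n)
  moreover have "\<forall>\<^sub>F i in sequentially. \<bar>z\<bar> \<le> (\<bar>of_int b\<bar> + \<bar>of_int c\<bar>) / real i"
    using eventually_ge_at_top[of k] eventually_gt_at_top[of 0] by eventually_elim (rule bound)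
  ultimately have "\<bar>z\<bar> \<le> 0" by (rule tendsto_lowerbound) simp
  then have "z = 0" by simp
  from nonquadratic[OF this[unfolded z_def]] have "b = 0" "c = 0" by auto
  then show False using not_proportional[of k] by (auto simp: b_def c_def mult_ac)
qed

lemma no_smaller_point:
  fixes u0 u1 u2 :: int
  assumes "\<bar>u0\<bar> < X (Suc i)" "\<bar>of_int u0 * \<xi> - of_int u1\<bar> < L i" "\<bar>of_int u0 * \<xi>\<^sup>2 - of_int u2\<bar> < L i"
  shows "(u0, u1, u2) = (0, 0, 0)"
proof (rule ccontr)
  assume nz: "(u0, u1, u2) \<noteq> (0, 0, 0)"
  define e where "e = max \<bar>of_int u0 * \<xi> - of_int u1\<bar> \<bar>of_int u0 * \<xi>\<^sup>2 - of_int u2\<bar>"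
  have "e < L i" using assms by (simp add: e_def)
  moreover from this err_le_half[of "den i"] have "e < 1" by linarith
  moreover have "\<bar>of_int u0 * \<xi> - of_int u1\<bar> \<le> e" "\<bar>of_int u0 * \<xi>\<^sup>2 - of_int u2\<bar> \<le> e"
    by (simp_all add: e_def)
  ultimately have "u0 \<noteq> 0" "err (nat \<bar>u0\<bar>) < L i"
    using err_integer_point_le[OF nz, of e] by auto
  moreover from assms(1) \<open>u0 \<noteq> 0\<close> have "L i \<le> err (nat \<bar>u0\<bar>)"
    by (intro den_minimal) (auto simp: X_def)
  ultimately show False by linarith
qed

text \<open>Subtracting the nearest integer combination from a point in the plane leaves a combination with
coefficients at most \<open>1 / 2\<close> in absolute value. It beats the two minimal points, so it is zero.\<close>

lemma consecutive_basis:
  fixes v0 v1 v2 :: int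
  assumes det: "v0 * (P i * Q (Suc i) - Q i * P (Suc i)) - v1 * (X i * Q (Suc i) - Q i * X (Suc i))
        + v2 * (X i * P (Suc i) - P i * X (Suc i)) = 0"
  obtains r s where "v0 = r * X i + s * X (Suc i)" "v1 = r * P i + s * P (Suc i)" "v2 = r * Q i + s * Q (Suc i)"
proof -
  from integer_plane_combination[OF det not_proportional] obtain d a b where
    d: "d \<noteq> 0" "d * v0 = a * X i + b * X (Suc i)" "d * v1 = a * P i + b * P (Suc i)"
        "d * v2 = a * Q i + b * Q (Suc i)" .
  define r s where "r = round (of_int a / of_int d :: real)" and "s = round (of_int b / of_int d :: real)"
  define r' s' where "r' = of_int a / of_int d - real_of_int r" and "s' = of_int b / of_int d - real_of_int s"
  have rs: "\<bar>r'\<bar> \<le> 1 / 2" "\<bar>s'\<bar> \<le> 1 / 2"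
    unfolding r'_def s'_def r_def s_def using of_int_round_abs_le by (metis abs_minus_commute)+
  have average: "\<bar>x + y\<bar> \<le> (p + q) / 2" if "\<bar>x\<bar> \<le> 1 / 2 * p" "\<bar>y\<bar> \<le> 1 / 2 * q"
    for x y p q :: real
    using that abs_triangle_ineq[of x y] by (simp add: field_simps)
  define u0 u1 u2 where "u0 = v0 - (r * X i + s * X (Suc i))" and "u1 = v1 - (r * P i + s * P (Suc i))"
    and "u2 = v2 - (r * Q i + s * Q (Suc i))"
  have "real_of_int d * of_int v0 = of_int a * of_int (X i) + of_int b * of_int (X (Suc i))"
    "real_of_int d * of_int v1 = of_int a * of_int (P i) + of_int b * of_int (P (Suc i))"
    "real_of_int d * of_int v2 = of_int a * of_int (Q i) + of_int b * of_int (Q (Suc i))"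
    using d(2-4) by (metis of_int_add of_int_mult)+
  then have u: "real_of_int u0 = r' * of_int (X i) + s' * of_int (X (Suc i))"
    "real_of_int u1 = r' * of_int (P i) + s' * of_int (P (Suc i))"
    "real_of_int u2 = r' * of_int (Q i) + s' * of_int (Q (Suc i))"
    using d(1) by (simp_all add: u0_def u1_def u2_def r'_def s'_def field_simps)
  have "of_int u0 * \<xi> - of_int u1 = r' * \<alpha> i + s' * \<alpha> (Suc i)"
    "of_int u0 * \<xi>\<^sup>2 - of_int u2 = r' * \<beta> i + s' * \<beta> (Suc i)"
    by (simp_all add: u \<alpha>_def \<beta>_def algebra_simps)
  moreover have "\<bar>r' * \<alpha> i\<bar> \<le> 1 / 2 * L i" "\<bar>s' * \<alpha> (Suc i)\<bar> \<le> 1 / 2 * L (Suc i)"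
    "\<bar>r' * \<beta> i\<bar> \<le> 1 / 2 * L i" "\<bar>s' * \<beta> (Suc i)\<bar> \<le> 1 / 2 * L (Suc i)"
    using rs \<alpha>_le \<beta>_le by (intro abs_mult_le; simp)+
  ultimately have small: "\<bar>of_int u0 * \<xi> - of_int u1\<bar> \<le> (L i + L (Suc i)) / 2"
    "\<bar>of_int u0 * \<xi>\<^sup>2 - of_int u2\<bar> \<le> (L i + L (Suc i)) / 2" using average by simp_all
  have "\<bar>r' * of_int (X i)\<bar> \<le> 1 / 2 * of_int (X i)" "\<bar>s' * of_int (X (Suc i))\<bar> \<le> 1 / 2 * of_int (X (Suc i))"
    using rs X_pos[of i] X_pos[of "Suc i"] by (intro abs_mult_le; simp)+
  then have "\<bar>real_of_int u0\<bar> \<le> (of_int (X i) + of_int (X (Suc i))) / 2"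
    unfolding u by (intro average)
  moreover have "real_of_int (X i) < of_int (X (Suc i))" using X_less_Suc by simp
  ultimately have "\<bar>real_of_int u0\<bar> < of_int (X (Suc i))" by (simp add: field_simps)
  then have u0: "\<bar>u0\<bar> < X (Suc i)" by simp
  have lt: "(L i + L (Suc i)) / 2 < L i" using den_Suc_less[of i] by simp
  have "(u0, u1, u2) = (0, 0, 0)"
    by (rule no_smaller_point[OF u0 order_le_less_trans[OF small(1) lt] order_le_less_trans[OF small(2) lt]])
  then show ?thesis using that[of r s] by (simp add: u0_def u1_def u2_def)
qed

text \<open>Only two coordinates of the cross product of consecutive points are recorded; since \<open>X\<close> is nonzero,
these two already detect proportionality.\<close>

definition wedge :: "nat \<Rightarrow> int" where
  "wedge i = max \<bar>X i * P (Suc i) - X (Suc i) * P i\<bar> \<bar>X i * Q (Suc i) - X (Suc i) * Q i\<bar>"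

lemma wedge_ge_1: "1 \<le> wedge i"
  unfolding wedge_def using not_proportional[of i] by linarith

text \<open>Within a plane the earlier pair is expressed by the later one through an integer matrix, whose
determinant is the ratio of the wedges.\<close>

lemma wedge_Suc_le:
  assumes "triple_det i = 0"
  shows "wedge (Suc i) \<le> wedge i"
proof -
  have "X i * (P (Suc i) * Q (Suc (Suc i)) - Q (Suc i) * P (Suc (Suc i)))
      - P i * (X (Suc i) * Q (Suc (Suc i)) - Q (Suc i) * X (Suc (Suc i)))
      + Q i * (X (Suc i) * P (Suc (Suc i)) - P (Suc i) * X (Suc (Suc i))) = 0"
    using assms by (simp add: triple_det_def)
  from consecutive_basis[OF this] obtain r s where
    rs: "X i = r * X (Suc i) + s * X (Suc (Suc i))" "P i = r * P (Suc i) + s * P (Suc (Suc i))"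
      "Q i = r * Q (Suc i) + s * Q (Suc (Suc i))" .
  have "X i * P (Suc i) - X (Suc i) * P i = - s * (X (Suc i) * P (Suc (Suc i)) - X (Suc (Suc i)) * P (Suc i))"
    "X i * Q (Suc i) - X (Suc i) * Q i = - s * (X (Suc i) * Q (Suc (Suc i)) - X (Suc (Suc i)) * Q (Suc i))"
    using rs by algebra+
  then have eq: "wedge i = \<bar>s\<bar> * wedge (Suc i)"
    unfolding wedge_def by (simp only: abs_mult abs_minus_cancel max_mult_distrib_left abs_ge_zero if_True)
  have "s \<noteq> 0" using eq wedge_ge_1[of i] by auto
  then have "1 * wedge (Suc i) \<le> \<bar>s\<bar> * wedge (Suc i)"
    using wedge_ge_1[of "Suc i"] by (intro mult_right_mono) auto
  with eq show ?thesis by simp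
qed

lemma wedge_le_of_gap:
  assumes "i < j" "\<And>k. i < k \<Longrightarrow> k < j \<Longrightarrow> triple_det k = 0"
  shows "wedge j \<le> wedge (Suc i)"
proof -
  from assms(1) have "Suc i \<le> j" by simp
  then show ?thesis using assms(2)
  proof (induction j rule: dec_induct)
    case (step n)
    then have "wedge (Suc n) \<le> wedge n" by (intro wedge_Suc_le) auto
    moreover have "wedge n \<le> wedge (Suc i)" using step by auto
    ultimately show ?case by linarith
  qed simp
qed

lemma wedge_bounds:
  "real_of_int (wedge i) \<le> 2 * (of_int (X (Suc i)) * L i)"
  "of_int (X (Suc i)) * L i \<le> real_of_int (wedge i) + of_int (X i) * L (Suc i)"
proof -
  let ?x = "real_of_int (X i)" and ?y = "real_of_int (X (Suc i))"
  have w: "real_of_int (wedge i) = max \<bar>?y * \<alpha> i - ?x * \<alpha> (Suc i)\<bar> \<bar>?y * \<beta> i - ?x * \<beta> (Suc i)\<bar>"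
    unfolding wedge_def of_int_max of_int_abs of_int_diff of_int_mult of_int_P of_int_Q
    by (simp add: algebra_simps)
  have xy: "0 \<le> ?x" "?x \<le> ?y" using X_less_Suc[of i] X_pos[of i] by simp_all
  have L: "L (Suc i) \<le> L i" using den_Suc_less[of i] by simp
  have s: "\<bar>?x * \<alpha> (Suc i)\<bar> \<le> ?x * L (Suc i)" "\<bar>?x * \<beta> (Suc i)\<bar> \<le> ?x * L (Suc i)"
    using xy \<alpha>_le \<beta>_le by (intro abs_mult_le; simp)+
  have t: "\<bar>?y * \<alpha> i\<bar> \<le> ?y * L i" "\<bar>?y * \<beta> i\<bar> \<le> ?y * L i"
    using xy \<alpha>_le \<beta>_le by (intro abs_mult_le; simp)+
  have "?x * L (Suc i) \<le> ?y * L i" using xy L L_pos[of "Suc i"] by (intro mult_mono) auto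
  with s t show "real_of_int (wedge i) \<le> 2 * (?y * L i)" unfolding w by linarith
  have "?y * L i = max \<bar>?y * \<alpha> i\<bar> \<bar>?y * \<beta> i\<bar>"
    using xy by (simp add: L_eq abs_mult max_mult_distrib_left)
  with s show "?y * L i \<le> real_of_int (wedge i) + ?x * L (Suc i)" unfolding w by linarith
qed

section \<open>Growth along the independent triples\<close>

abbreviation a :: "nat \<Rightarrow> real" where "a i \<equiv> ln (of_int (X i))"
abbreviation l :: "nat \<Rightarrow> real" where "l i \<equiv> ln (L i)"

lemma log_L_upper: "l i \<le> ln (2 * c') + (1 - golden_ratio) * a (Suc i)"
proof -
  have x: "0 < real_of_int (X (Suc i))" using X_pos by simp
  have "l i \<le> ln (2 * c' * of_int (X (Suc i)) powr (1 - golden_ratio))"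
    using L_le_power[of i] L_pos[of i] by (simp only: ln_mono)
  also have "\<dots> = ln (2 * c') + (1 - golden_ratio) * a (Suc i)"
    using x c'_pos by (simp add: ln_mult ln_powr)
  finally show ?thesis .
qed

lemma log_L_lower:
  assumes "X i * Q i \<noteq> (P i)\<^sup>2"
  shows "0 \<le> ln (2 + 2 * \<bar>\<xi>\<bar>) + a i + l i"
proof -
  have "1 \<le> \<bar>X i * Q i - (P i)\<^sup>2\<bar>" using assms by linarith
  then have "1 \<le> \<bar>real_of_int (X i * Q i - (P i)\<^sup>2)\<bar>" by linarith
  with discriminant_bound[of i] have "1 \<le> (2 + 2 * \<bar>\<xi>\<bar>) * of_int (X i) * L i" by linarith
  then have "0 \<le> ln ((2 + 2 * \<bar>\<xi>\<bar>) * of_int (X i) * L i)" by simp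
  also have "\<dots> = ln (2 + 2 * \<bar>\<xi>\<bar>) + a i + l i"
    using X_pos[of i] L_pos[of i] by (simp add: ln_mult add_pos_nonneg)
  finally show ?thesis .
qed

lemma log_triple_lower:
  assumes "triple_det i \<noteq> 0"
  shows "0 \<le> ln 6 + a (i+2) + l (i+1) + l i"
proof -
  have "1 \<le> \<bar>triple_det i\<bar>" using assms by linarith
  then have "1 \<le> \<bar>real_of_int (triple_det i)\<bar>" by linarith
  with triple_det_bound[of i] have "1 \<le> 6 * (of_int (X (i+2)) * (L (i+1) * L i))" by linarith
  then have "0 \<le> ln (6 * (of_int (X (i+2)) * (L (i+1) * L i)))" by simp
  also have "\<dots> = ln 6 + a (i+2) + l (i+1) + l i"
    using X_pos[of "i+2"] L_pos[of i] L_pos[of "i+1"] by (simp add: ln_mult)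
  finally show ?thesis .
qed

lemma log_wedge_upper: "ln (of_int (wedge i)) \<le> ln 2 + a (Suc i) + l i"
proof -
  have "ln (of_int (wedge i)) \<le> ln (2 * (of_int (X (Suc i)) * L i))"
    using wedge_bounds(1)[of i] wedge_ge_1[of i] by (intro ln_mono) auto
  also have "\<dots> = ln 2 + a (Suc i) + l i"
    using X_pos[of "Suc i"] L_pos[of i] by (simp add: ln_mult)
  finally show ?thesis .
qed

lemma a_mono: "i \<le> j \<Longrightarrow> a i \<le> a j"
  using X_mono[of i j] X_pos[of i] by simp

text \<open>The lower bound holds since, up to a constant, \<open>a\<close> already gains the factor \<open>golden_ratio\<close> from
\<open>i + 1\<close> to \<open>i + 2\<close>. For the upper bound, \<open>wedge j\<close> is comparable with \<open>X (j + 1) * L j\<close> and at most \<open>wedge (i + 1)\<close>, which in turn is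
at most a multiple of \<open>X (i + 2) * L (i + 1)\<close>; the two products are estimated by \<open>golden_estimates\<close>.\<close>

lemma consecutive_independent_triples:
  fixes C :: real
  assumes C: "ln (2 * c') \<le> C" "ln (2 + 2 * \<bar>\<xi>\<bar>) \<le> C" "ln 6 \<le> C"
    and det: "X (i+1) * Q (i+1) \<noteq> (P (i+1))\<^sup>2" "X (j+1) * Q (j+1) \<noteq> (P (j+1))\<^sup>2"
    and triple: "triple_det i \<noteq> 0" "triple_det j \<noteq> 0"
    and gap: "i < j" "\<And>k. i < k \<Longrightarrow> k < j \<Longrightarrow> triple_det k = 0"
  shows "\<bar>a (j+1) - golden_ratio * a (i+1)\<bar> \<le> 80 * C"
proof -
  let ?g = golden_ratio
  have g: "?g * ?g = ?g + 1" "3 / 2 < ?g" "?g < 17 / 10"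
    using golden_ratio_square golden_ratio_bounds by (simp_all add: power2_eq_square)
  have "0 \<le> ln (6 :: real)" "ln 2 \<le> ln (6 :: real)" by simp_all
  with C have C0: "0 \<le> C" "ln 2 \<le> C" by linarith+
  have up: "l k \<le> C + (1 - ?g) * a (k+1)" for k using log_L_upper[of k] C by simp
  have low1: "0 \<le> C + a (k+1) + l (k+1)" if "X (k+1) * Q (k+1) \<noteq> (P (k+1))\<^sup>2" for k
    using log_L_lower[OF that] C by linarith
  have low2: "0 \<le> C + a (k+2) + l (k+1) + l k" if "triple_det k \<noteq> 0" for k
    using log_triple_lower[OF that] C by linarith
  note at_i = golden_estimates[OF C0(1) up[of i] up[of "i+1", simplified add.assoc one_add_one] low1[OF det(1)] low2[OF triple(1)]]
  note at_j = golden_estimates[OF C0(1) up[of j] up[of "j+1", simplified add.assoc one_add_one] low1[OF det(2)] low2[OF triple(2)]]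
  have Wi: "ln (of_int (wedge (i+1))) \<le> 13 * C + (?g - 1) * a (i+1)"
    using log_wedge_upper[of "i+1"] at_i(1,3) C0 by (simp add: algebra_simps)
  have "of_int (X j) * L (j+1) \<le> exp (8 * C)"
  proof -
    have "ln (of_int (X j) * L (j+1)) \<le> 8 * C"
      using at_j(3) a_mono[of j "j+1"] X_pos[of j] L_pos[of "j+1"] by (simp add: ln_mult)
    moreover have "0 < of_int (X j) * L (j+1)" using X_pos[of j] L_pos[of "j+1"] by simp
    ultimately show ?thesis by (metis exp_le_cancel_iff exp_ln)
  qed
  moreover have "exp (8 * C) \<le> of_int (wedge j) * exp (8 * C)"
    using wedge_ge_1[of j] by simp
  moreover have "of_int (wedge j) \<le> of_int (wedge j) * exp (8 * C)"
    using wedge_ge_1[of j] C0 by simp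
  ultimately have "of_int (X (j+1)) * L j \<le> 2 * (of_int (wedge j) * exp (8 * C))"
    using wedge_bounds(2)[of j] unfolding Suc_eq_plus1 by linarith
  then have "ln (of_int (X (j+1)) * L j) \<le> ln (2 * (of_int (wedge j) * exp (8 * C)))"
    using X_pos[of "j+1"] L_pos[of j] by (intro ln_mono) auto
  then have "a (j+1) + l j \<le> ln 2 + ln (of_int (wedge j)) + 8 * C"
    using X_pos[of "j+1"] L_pos[of j] wedge_ge_1[of j] by (simp add: ln_mult)
  moreover have "ln (of_int (wedge j)) \<le> ln (real_of_int (wedge (i+1)))"
    using wedge_le_of_gap[OF gap] wedge_ge_1[of j] by simp
  ultimately have "(2 - ?g) * a (j+1) \<le> 26 * C + (?g - 1) * a (i+1)"
    using Wi at_j(4) C0 by (simp add: algebra_simps)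
  then have "(?g + 1) * ((2 - ?g) * a (j+1)) \<le> (?g + 1) * (26 * C + (?g - 1) * a (i+1))"
    using g by (intro mult_left_mono) auto
  moreover have "(?g + 1) * ((2 - ?g) * a (j+1)) = a (j+1)" using g(1) by algebra
  moreover have "(?g + 1) * (26 * C + (?g - 1) * a (i+1)) = 26 * (?g * C) + 26 * C + ?g * a (i+1)"
    using g(1) by algebra
  moreover have "?g * C \<le> 17 / 10 * C" using g C0 by (intro mult_right_mono) auto
  ultimately have "a (j+1) \<le> ?g * a (i+1) + 80 * C" using C0 by linarith
  moreover have "a (i+2) \<le> a (j+1)" using gap(1) by (intro a_mono) simp
  with at_i(2) have "?g * a (i+1) - 9 * C \<le> a (j+1)" by linarith
  ultimately show ?thesis using C0 by linarith
qed

lemma L_le_inverse: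
  fixes C :: real
  assumes C: "ln (2 * c') \<le> C" "ln (2 + 2 * \<bar>\<xi>\<bar>) \<le> C" "ln 6 \<le> C"
    and det: "X (i+1) * Q (i+1) \<noteq> (P (i+1))\<^sup>2" and triple: "triple_det i \<noteq> 0"
  shows "L (i+1) \<le> exp (8 * C) / of_int (X (i+1))"
proof -
  have "0 \<le> ln (6 :: real)" by simp
  with C have C0: "0 \<le> C" by linarith
  have "l (i+1) \<le> 8 * C - a (i+1)"
    using log_L_upper[of i] log_L_upper[of "i+1"] log_L_lower[OF det] log_triple_lower[OF triple] C
    by (intro golden_estimates(3)[OF C0, of "l i" _ _ "a (i+2)"]) auto
  then have "exp (l (i+1)) \<le> exp (8 * C - a (i+1))" by simp
  then show ?thesis using L_pos[of "i+1"] X_pos[of "i+1"] by (simp add: exp_diff)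
qed

text \<open>The sequence consists of the middle points of the independent triples, from the index on at which
the determinants \<open>X * Q - P\<^sup>2\<close> no longer vanish.\<close>

proposition approximation_sequence:
  obtains K :: real and y p r :: "nat \<Rightarrow> int" where
    "\<And>k. 0 < y k" "\<And>k. \<bar>of_int (y k) * \<xi> - of_int (p k)\<bar> \<le> K / of_int (y k)"
    "\<And>k. \<bar>of_int (y k) * \<xi>\<^sup>2 - of_int (r k)\<bar> \<le> K / of_int (y k)"
    "\<And>k. y k * r k \<noteq> (p k)\<^sup>2"
    "\<And>k. \<bar>ln (of_int (y (Suc k))) - golden_ratio * ln (of_int (y k))\<bar> \<le> K"
    "filterlim (\<lambda>k. real_of_int (y k)) at_top sequentially"
proof -
  obtain N where N: "\<And>i. N \<le> i \<Longrightarrow> X i * Q i \<noteq> (P i)\<^sup>2"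
    using eventually_discriminant_nonzero by (auto simp: eventually_sequentially)
  define I where "I = {i. triple_det i \<noteq> 0} - {..<N}"
  have I: "infinite I" unfolding I_def using infinite_triple_det_nonzero by (simp add: Diff_infinite_finite)
  define s where "s = enumerate I"
  have sI: "s k \<in> I" for k unfolding s_def by (rule enumerate_in_set[OF I])
  have s_less: "s k < s (Suc k)" for k unfolding s_def by (rule enumerate_step[OF I])
  have s_gap: "triple_det i = 0" if "s k < i" "i < s (Suc k)" for i k
  proof (rule ccontr)
    assume "triple_det i \<noteq> 0"
    then have "i \<in> I" using that(1) sI[of k] by (auto simp: I_def)
    with that(1) have "s (Suc k) \<le> i"
      unfolding s_def enumerate_Suc''[OF I] by (intro Least_le) auto
    with that(2) show False by simp
  qed
  have triple: "triple_det (s k) \<noteq> 0" and det: "X (s k + 1) * Q (s k + 1) \<noteq> (P (s k + 1))\<^sup>2" for k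
    using sI[of k] N[of "s k + 1"] by (simp_all add: I_def)
  define C where "C = max (ln (2 * c')) (max (ln (2 + 2 * \<bar>\<xi>\<bar>)) (ln 6))"
  have C: "ln (2 * c') \<le> C" "ln (2 + 2 * \<bar>\<xi>\<bar>) \<le> C" "ln 6 \<le> C" unfolding C_def by linarith+
  have C0: "0 \<le> C" using C(3) ln_ge_zero[of 6] by linarith
  define K where "K = exp (8 * C) + 80 * C"
  have K: "exp (8 * C) \<le> K" "80 * C \<le> K" using C0 by (simp_all add: K_def)
  have L: "L (s k + 1) \<le> K / of_int (X (s k + 1))" for k
  proof -
    note L_le_inverse[OF C det triple, of k]
    also have "exp (8 * C) / of_int (X (s k + 1)) \<le> K / of_int (X (s k + 1))"
      using X_pos[of "s k + 1"] K by (intro divide_right_mono) auto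
    finally show ?thesis .
  qed
  have "strict_mono s" using s_less by (simp add: strict_mono_Suc_iff)
  then have "strict_mono (\<lambda>k. s k + 1)" by (auto simp: strict_mono_def)
  then have lim: "filterlim (\<lambda>k. real_of_int (X (s k + 1))) at_top sequentially"
    unfolding X_def of_int_of_nat_eq by (intro filterlim_compose[OF filterlim_den] filterlim_subseq)
  show ?thesis
  proof (rule that[of "\<lambda>k. X (s k + 1)" "\<lambda>k. P (s k + 1)" K "\<lambda>k. Q (s k + 1)"])
    show "\<bar>of_int (X (s k + 1)) * \<xi> - of_int (P (s k + 1))\<bar> \<le> K / of_int (X (s k + 1))" for k
      using \<alpha>_le[of "s k + 1"] L[of k] unfolding \<alpha>_def by linarith
    show "\<bar>of_int (X (s k + 1)) * \<xi>\<^sup>2 - of_int (Q (s k + 1))\<bar> \<le> K / of_int (X (s k + 1))" for k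
      using \<beta>_le[of "s k + 1"] L[of k] unfolding \<beta>_def by linarith
    show "\<bar>a (s (Suc k) + 1) - golden_ratio * a (s k + 1)\<bar> \<le> K" for k
    proof -
      have "\<bar>a (s (Suc k) + 1) - golden_ratio * a (s k + 1)\<bar> \<le> 80 * C"
        by (rule consecutive_independent_triples[OF C det det triple triple s_less]) (rule s_gap)
      then show ?thesis using K(2) by (rule order_trans)
    qed
  qed (fact X_pos det lim)+
qed

end
section \<open>Logarithmic loss along the sequence\<close>

text \<open>Bernoulli's inequality for the powers of \<open>6 / 5\<close>, whose square is below the golden ratio.\<close>

lemma quadratic_below_golden_power: "(real k)\<^sup>2 / 25 \<le> golden_ratio ^ k"
proof -
  have "(real k / 5)\<^sup>2 \<le> ((6 / 5) ^ k)\<^sup>2"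
    using Bernoulli_inequality[of "1 / 5 :: real" k] by (intro power_mono) simp_all
  also have "\<dots> = (36 / 25) ^ k" by (simp add: power2_eq_square flip: power_mult_distrib)
  also have "\<dots> \<le> golden_ratio ^ k" using golden_ratio_bounds by (intro power_mono) auto
  finally show ?thesis by (simp add: power_divide)
qed

text \<open>A height \<open>h\<close> comes into the range of the \<open>k\<close>-th gap once \<open>golden_ratio ^ k\<close> exceeds
\<open>2 * ln h\<close> by a constant: the factor \<open>c0 / D ^ k\<close> in the cutoff costs only \<open>k * ln D\<close> on the logarithmic
scale, which one of the two copies of \<open>golden_ratio ^ k\<close> in \<open>2 * ln (y k)\<close> absorbs. For the first such
\<open>k\<close>, the loss \<open>D ^ k\<close> is at most a constant times the power of \<open>1 + ln h\<close> with exponent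
\<open>ln D / ln golden_ratio\<close>.\<close>

lemma logarithmic_bound_from_gaps:
  fixes \<xi> c0 D :: real and y :: "nat \<Rightarrow> int"
  assumes c0: "0 < c0" and D: "1 < D"
    and y: "\<And>k. 0 < y k" "\<And>k. golden_ratio ^ k \<le> ln (of_int (y k))"
    and gap: "\<And>k. gap_up_to \<xi> (c0 / D ^ k) (of_int (y k))"
  obtains c t :: real where "0 < c" "0 < t"
    "\<And>p q :: int. (p, q) \<noteq> (0, 0) \<Longrightarrow>
       c * (1 + ln (of_int (max \<bar>p\<bar> \<bar>q\<bar>))) powr (- t) \<le> of_int (max \<bar>p\<bar> \<bar>q\<bar>) * \<bar>of_int q * \<xi> - of_int p\<bar>"
proof -
  let ?g = golden_ratio
  have g: "1 < ?g" using golden_ratio_bounds by simp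
  define E where "E = ln D"
  define B where "B = 25 / 4 * E\<^sup>2 + \<bar>ln c0\<bar>"
  define t where "t = E / ln ?g"
  have E: "0 < E" "exp E = D" using D by (simp_all add: E_def)
  have B0: "0 \<le> B" by (simp add: B_def)
  have t: "0 < t" using E g by (simp add: t_def)
  have absorb: "real k * E - ln c0 \<le> ?g ^ k + B" for k
  proof -
    have "0 \<le> (real k / 5 - 5 * E / 2)\<^sup>2" by simp
    also have "\<dots> = (real k)\<^sup>2 / 25 - real k * E + 25 / 4 * E\<^sup>2"
      by (simp add: power2_eq_square field_simps)
    finally show ?thesis using quadratic_below_golden_power[of k] unfolding B_def by linarith
  qed
  have Dk: "D ^ k = exp (real k * E)" for k by (simp add: exp_of_nat_mult E(2))
  define c where "c = c0 / (D * (B + 2) powr t)"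
  have c: "0 < c" using c0 D B0 by (simp add: c_def)
  show ?thesis
  proof (rule that[OF c t])
    fix p q :: int
    assume pq: "(p, q) \<noteq> (0, 0)"
    define h where "h = real_of_int (max \<bar>p\<bar> \<bar>q\<bar>)"
    have h: "1 \<le> h" using max_abs_ge_1[OF pq] by (simp add: h_def)
    then have h0: "0 \<le> ln h" by simp
    define u where "u = 2 * ln h + B + 1"
    have u: "1 \<le> u" using h0 B0 by (simp add: u_def)
    define k where "k = nat \<lceil>log ?g u\<rceil>"
    have log0: "0 \<le> log ?g u" using g u by simp
    have k: "log ?g u \<le> real k" "real k \<le> log ?g u + 1" using log0 by (simp_all add: k_def)
    have "u = ?g powr (log ?g u)" using g u by simp
    also have "\<dots> \<le> ?g powr (real k)" using g k by (intro powr_mono) auto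
    finally have gk: "u \<le> ?g ^ k" using g by (simp add: powr_realpow)
    have "ln (h\<^sup>2) \<le> ln (c0 / D ^ k * (of_int (y k))\<^sup>2)"
    proof -
      have "ln (c0 / D ^ k * (of_int (y k))\<^sup>2) = ln c0 - real k * E + 2 * ln (of_int (y k))"
        using c0 D y(1)[of k] by (simp add: ln_mult ln_div ln_realpow E_def)
      moreover have "ln (h\<^sup>2) = 2 * ln h" using h by (simp add: ln_realpow)
      ultimately show ?thesis using absorb[of k] gk y(2)[of k] unfolding u_def by linarith
    qed
    moreover have "0 < h\<^sup>2" "0 < c0 / D ^ k * (of_int (y k))\<^sup>2" using h c0 D y(1)[of k] by simp_all
    ultimately have "h\<^sup>2 \<le> c0 / D ^ k * (of_int (y k))\<^sup>2" by simp
    with gap[of k] pq have lower: "c0 / D ^ k \<le> h * \<bar>of_int q * \<xi> - of_int p\<bar>"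
      unfolding gap_up_to_def h_def by blast
    have "real k * E \<le> (log ?g u + 1) * E" using k E by (intro mult_right_mono) auto
    also have "\<dots> = E + t * ln u" by (simp add: t_def log_def algebra_simps)
    finally have "D ^ k \<le> exp (E + t * ln u)" unfolding Dk by simp
    also have "\<dots> = D * u powr t" using u E by (simp add: exp_add powr_def)
    also have "\<dots> \<le> D * ((B + 2) * (1 + ln h)) powr t"
    proof -
      have "u \<le> (B + 2) * (1 + ln h)" using B0 h0 by (simp add: u_def algebra_simps)
      then show ?thesis using u t D by (intro mult_left_mono powr_mono2) auto
    qed
    also have "\<dots> = D * (B + 2) powr t * (1 + ln h) powr t" using B0 h0 by (simp add: powr_mult)
    finally have "c0 / (D * (B + 2) powr t * (1 + ln h) powr t) \<le> c0 / D ^ k"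
      using c0 D by (intro frac_le) auto
    also have "c0 / (D * (B + 2) powr t * (1 + ln h) powr t) = c * (1 + ln h) powr (- t)"
      by (simp add: c_def powr_minus divide_simps)
    finally show "c * (1 + ln (of_int (max \<bar>p\<bar> \<bar>q\<bar>))) powr (- t)
        \<le> of_int (max \<bar>p\<bar> \<bar>q\<bar>) * \<bar>of_int q * \<xi> - of_int p\<bar>"
      using lower unfolding h_def by linarith
  qed
qed

text \<open>Each step needs the gap at two consecutive levels, the lower one serving as \<open>R\<close>; carrying both
with a common constant makes the loss one factor \<open>D\<close> per step.\<close>

lemma gap_along_golden_sequence:
  fixes \<xi> K :: real and y p r :: "nat \<Rightarrow> int"
  assumes pos: "\<And>k. 0 < y k"
    and approx: "\<And>k. \<bar>of_int (y k) * \<xi> - of_int (p k)\<bar> \<le> K / of_int (y k)"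
      "\<And>k. \<bar>of_int (y k) * \<xi>\<^sup>2 - of_int (r k)\<bar> \<le> K / of_int (y k)"
    and det: "\<And>k. y k * r k \<noteq> (p k)\<^sup>2"
    and growth: "\<And>k. \<bar>ln (of_int (y (Suc k))) - golden_ratio * ln (of_int (y k))\<bar> \<le> K"
  obtains c0 D where "0 < c0" "1 < D" "\<And>k. gap_up_to \<xi> (c0 / D ^ k) (of_int (y k))"
proof -
  let ?g = golden_ratio
  have g: "?g * ?g = ?g + 1" "3 / 2 < ?g" "?g < 17 / 10"
    using golden_ratio_square golden_ratio_bounds by (simp_all add: power2_eq_square)
  have K0: "0 \<le> K" using growth[of 0] by linarith
  define M where "M = exp (3 * K) + \<bar>\<xi>\<bar>"
  have M: "1 \<le> M" "\<bar>\<xi>\<bar> \<le> M" "K \<le> M" "exp (3 * K) \<le> M"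
    using K0 exp_ge_add_one_self[of "3 * K"] unfolding M_def by linarith+
  have approxM: "\<bar>of_int (y k) * \<xi> - of_int (p k)\<bar> \<le> M / of_int (y k)"
      "\<bar>of_int (y k) * \<xi>\<^sup>2 - of_int (r k)\<bar> \<le> M / of_int (y k)" for k
    using approx[of k] divide_right_mono[OF M(3), of "of_int (y k)"] pos[of k]
    by (simp_all add: order_less_imp_le)
  have ratio: "of_int (y (Suc (Suc k))) \<le> M * of_int (y (Suc k)) * of_int (y k)"
    "of_int (y (Suc k)) * of_int (y k) \<le> M * of_int (y (Suc (Suc k)))" for k
  proof -
    define a0 a1 a2 where "a0 = ln (real_of_int (y k))" and "a1 = ln (real_of_int (y (Suc k)))"
      and "a2 = ln (real_of_int (y (Suc (Suc k))))"
    have e: "real_of_int (y k) = exp a0" "real_of_int (y (Suc k)) = exp a1"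
      "real_of_int (y (Suc (Suc k))) = exp a2"
      using pos[of k] pos[of "Suc k"] pos[of "Suc (Suc k)"] by (simp_all add: a0_def a1_def a2_def)
    have d: "\<bar>a2 - ?g * a1\<bar> \<le> K" "\<bar>a1 - ?g * a0\<bar> \<le> K"
      using growth[of k] growth[of "Suc k"] by (simp_all add: a0_def a1_def a2_def)
    have "\<bar>(?g - 1) * (a1 - ?g * a0)\<bar> \<le> 1 * K"
      using d g by (intro abs_mult_le) auto
    moreover have "a2 - a1 - a0 = (a2 - ?g * a1) + (?g - 1) * (a1 - ?g * a0)" using g(1) by algebra
    ultimately have d: "a2 \<le> 3 * K + a1 + a0" "a1 + a0 \<le> 3 * K + a2" using d K0 by linarith+
    have "exp a2 \<le> exp (3 * K) * exp a1 * exp a0" using d(1) by (simp flip: exp_add)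
    also have "\<dots> \<le> M * exp a1 * exp a0" using M(4) by (intro mult_right_mono) auto
    finally show "of_int (y (Suc (Suc k))) \<le> M * of_int (y (Suc k)) * of_int (y k)" unfolding e .
    have "exp a1 * exp a0 \<le> exp (3 * K) * exp a2" using d(2) by (simp flip: exp_add)
    also have "\<dots> \<le> M * exp a2" using M(4) by (intro mult_right_mono) auto
    finally show "of_int (y (Suc k)) * of_int (y k) \<le> M * of_int (y (Suc (Suc k)))" unfolding e .
  qed
  define D where "D = 128 * M ^ 10"
  have "1 \<le> M ^ 10" using M(1) by (rule one_le_power)
  then have D: "1 < D" by (simp add: D_def)
  define S where "S = (real_of_int (y 0))\<^sup>2 + (real_of_int (y 1))\<^sup>2"
  \<comment> \<open>Small enough for the first two gaps to be vacuous.\<close>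
  define c0 where "c0 = 1 / (2 * S)"
  have S: "0 < S" using pos[of 0] by (simp add: S_def add_pos_nonneg)
  then have c0: "0 < c0" by (simp add: c0_def)
  have base: "gap_up_to \<xi> c0 (of_int (y 0))" "gap_up_to \<xi> c0 (of_int (y 1))"
  proof -
    have *: "c0 * x < 1" if "x \<le> S" for x
      using that S by (simp add: c0_def field_simps)
    show "gap_up_to \<xi> c0 (of_int (y 0))" "gap_up_to \<xi> c0 (of_int (y 1))"
      by (intro gap_up_to_trivial *; simp add: S_def)+
  qed
  have step: "gap_up_to \<xi> (c0 / D ^ k) (of_int (y k)) \<and> gap_up_to \<xi> (c0 / D ^ k) (of_int (y (Suc k)))" for k
  proof (induction k)
    case 0
    show ?case using base by simp
  next
    case (Suc k)
    let ?c = "c0 / D ^ k"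
    have c: "0 < ?c" using c0 D by simp
    have cD: "?c / D = c0 / D ^ Suc k" by simp
    have "?c / D \<le> ?c / 1" using c D by (intro divide_left_mono) auto
    then have "?c / D \<le> ?c" by simp
    then have "gap_up_to \<xi> (?c / D) (of_int (y (Suc k)))" using Suc.IH gap_up_to_mono by blast
    moreover have "gap_up_to \<xi> (?c / D) (of_int (y (Suc (Suc k))))"
      unfolding D_def using Suc.IH pos c det[of "Suc k"] det[of "Suc (Suc k)"] 
      by (intro gap_up_to_step[OF M(1,2) pos pos _ approxM approxM _ _ ratio]) (auto simp: D_def)
    ultimately show ?case unfolding cD by blast
  qed
  show ?thesis using that[OF c0 D] step by blast
qed

lemma golden_growth:
  fixes b :: "nat \<Rightarrow> real"
  assumes growth: "\<And>k. \<bar>b (Suc k) - golden_ratio * b k\<bar> \<le> K"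
    and lim: "filterlim b at_top sequentially"
  obtains k0 where "\<And>k. golden_ratio ^ k \<le> b (k0 + k)"
proof -
  let ?g = golden_ratio
  have g: "3 / 2 < ?g" using golden_ratio_bounds by simp
  have K0: "0 \<le> K" using growth[of 0] by linarith
  \<comment> \<open>The fixed point of \<open>x \<mapsto> ?g * x - K\<close>: the recursion expands the distance above it by \<open>?g\<close>.\<close>
  define B where "B = K / (?g - 1)"
  have "(?g - 1) * B = K" "0 \<le> B" using g K0 by (simp_all add: B_def)
  then have B: "0 \<le> B" "?g * B - B = K" by (simp_all add: algebra_simps)
  obtain k0 where k0: "B + 1 \<le> b k0"
    using lim by (auto simp: filterlim_at_top eventually_sequentially)
  have "?g ^ k \<le> b (k0 + k) - B" for k
  proof (induction k)
    case 0
    show ?case using k0 by simp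
  next
    case (Suc k)
    have "?g * ?g ^ k \<le> ?g * (b (k0 + k) - B)" using Suc.IH g by (intro mult_left_mono) auto
    also have "\<dots> \<le> b (k0 + Suc k) - B" using growth[of "k0 + k"] B(2) by (simp add: algebra_simps)
    finally show ?case by simp
  qed
  then have "?g ^ k \<le> b (k0 + k)" for k using B(1) by (smt (verit))
  then show ?thesis by (rule that)
qed

section \<open>The bound for rational numbers\<close>

lemma extremal_imp_extremal_number:
  assumes "extremal \<xi>"
  obtains c' where "extremal_number \<xi> c'"
proof -
  have deg: "\<not> algebraic_degree_le 2 \<xi>" using assms by (simp add: extremal_def)
  have e: "- 1 / golden_ratio = 1 - golden_ratio"
    using golden_ratio_square golden_ratio_bounds by (simp add: field_simps power2_eq_square)
  obtain c' where c': "0 < c'" "\<And>X::real. 1 \<le> X \<Longrightarrow>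
        (\<exists>x0 x1 x2 :: int. (x0, x1, x2) \<noteq> (0, 0, 0) \<and> \<bar>of_int x0\<bar> \<le> X \<and>
           \<bar>of_int x0 * \<xi> - of_int x1\<bar> \<le> c' * X powr (1 - golden_ratio) \<and>
           \<bar>of_int x0 * \<xi>\<^sup>2 - of_int x2\<bar> \<le> c' * X powr (1 - golden_ratio))"
    using assms unfolding extremal_def e by blast
  have "a = 0 \<and> b = 0 \<and> c = 0" if z: "of_int a + of_int b * \<xi> + of_int c * \<xi>\<^sup>2 = 0" for a b c :: int
  proof (rule ccontr)
    assume nz: "\<not> (a = 0 \<and> b = 0 \<and> c = 0)"
    define p :: "rat poly" where "p = [:of_int a, of_int b, of_int c:]"
    have "p \<noteq> 0" "degree p \<le> 2" using nz by (auto simp: p_def)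
    moreover have "poly (map_poly of_rat p) \<xi> = 0"
      using z by (simp add: p_def map_poly_pCons algebra_simps power2_eq_square)
    ultimately show False using deg unfolding algebraic_degree_le_def by blast
  qed
  with c' have "extremal_number \<xi> c'" by unfold_locales auto
  then show ?thesis by (rule that)
qed

lemma extremal_gap:
  assumes "extremal \<xi>"
  obtains c t :: real where "0 < c" "0 < t"
    "\<And>p q :: int. (p, q) \<noteq> (0, 0) \<Longrightarrow>
       c * (1 + ln (of_int (max \<bar>p\<bar> \<bar>q\<bar>))) powr (- t) \<le> of_int (max \<bar>p\<bar> \<bar>q\<bar>) * \<bar>of_int q * \<xi> - of_int p\<bar>"
proof -
  obtain c' where "extremal_number \<xi> c'" by (rule extremal_imp_extremal_number[OF assms])
  then interpret extremal_number \<xi> c' .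
  obtain K and y p r :: "nat \<Rightarrow> int" where seq: "\<And>k. 0 < y k"
    "\<And>k. \<bar>of_int (y k) * \<xi> - of_int (p k)\<bar> \<le> K / of_int (y k)"
    "\<And>k. \<bar>of_int (y k) * \<xi>\<^sup>2 - of_int (r k)\<bar> \<le> K / of_int (y k)"
    "\<And>k. y k * r k \<noteq> (p k)\<^sup>2"
    "\<And>k. \<bar>ln (of_int (y (Suc k))) - golden_ratio * ln (of_int (y k))\<bar> \<le> K"
    and lim: "filterlim (\<lambda>k. real_of_int (y k)) at_top sequentially"
    by (rule approximation_sequence) blast
  have "filterlim (\<lambda>k. ln (real_of_int (y k))) at_top sequentially"
    by (rule filterlim_compose[OF ln_at_top lim])
  then obtain k0 where k0: "\<And>k. golden_ratio ^ k \<le> ln (of_int (y (k0 + k)))"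
    using golden_growth[of "\<lambda>k. ln (real_of_int (y k))" K, OF seq(5)] by blast
  have step: "\<bar>ln (of_int (y (k0 + Suc k))) - golden_ratio * ln (of_int (y (k0 + k)))\<bar> \<le> K" for k
    using seq(5)[of "k0 + k"] by simp
  obtain c0 D where cD: "0 < c0" "1 < D" "\<And>k. gap_up_to \<xi> (c0 / D ^ k) (of_int (y (k0 + k)))"
    by (rule gap_along_golden_sequence[of "\<lambda>k. y (k0 + k)" \<xi> "\<lambda>k. p (k0 + k)" K "\<lambda>k. r (k0 + k)"])
       (use seq(1-4) step in auto)
  show ?thesis
    by (rule logarithmic_bound_from_gaps[OF cD(1,2) _ k0 cD(3)]) (use seq(1) that in auto)
qed

theorem theorem1p3:
  fixes \<xi> :: real
  assumes "extremal \<xi>"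
  shows "\<exists>c>0. \<exists>t>0. \<forall>\<alpha>\<in>\<rat>.
           \<bar>\<xi> - \<alpha>\<bar> \<ge> c * alg_height \<alpha> powr (-2) * (1 + ln (alg_height \<alpha>)) powr (- t)"
proof -
  obtain c t :: real where ct: "0 < c" "0 < t"
    and gap: "\<And>p q :: int. (p, q) \<noteq> (0, 0) \<Longrightarrow>
       c * (1 + ln (of_int (max \<bar>p\<bar> \<bar>q\<bar>))) powr (- t) \<le> of_int (max \<bar>p\<bar> \<bar>q\<bar>) * \<bar>of_int q * \<xi> - of_int p\<bar>"
    by (rule extremal_gap[OF assms]) blast
  have "c * alg_height \<alpha> powr (-2) * (1 + ln (alg_height \<alpha>)) powr (- t) \<le> \<bar>\<xi> - \<alpha>\<bar>"
    if rational: "\<alpha> \<in> \<rat>" for \<alpha> :: real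
  proof -
    obtain p q :: int where pq: "q > 0" "coprime p q" "\<alpha> = of_int p / of_int q"
      by (rule Rats_cases'[OF rational]) blast
    define h where "h = real_of_int (max \<bar>p\<bar> \<bar>q\<bar>)"
    have height: "alg_height \<alpha> = h" unfolding pq(3) h_def by (rule alg_height_rational[OF pq(2,1)])
    have q: "0 < real_of_int q" "real_of_int q \<le> h" using pq(1) by (auto simp: h_def)
    have "c * h powr (-2) * (1 + ln h) powr (- t) = c * (1 + ln h) powr (- t) / h\<^sup>2"
      using q by (simp add: powr_minus powr_numeral divide_simps)
    also have "\<dots> \<le> h * \<bar>of_int q * \<xi> - of_int p\<bar> / h\<^sup>2"
      using gap[of p q] pq(1) unfolding h_def by (intro divide_right_mono) auto
    also have "\<dots> = \<bar>of_int q * \<xi> - of_int p\<bar> / h" using q by (simp add: power2_eq_square)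
    also have "\<dots> \<le> \<bar>of_int q * \<xi> - of_int p\<bar> / of_int q" using q by (intro divide_left_mono) auto
    also have "\<dots> = \<bar>(of_int q * \<xi> - of_int p) / of_int q\<bar>" using q by simp
    also have "(of_int q * \<xi> - of_int p) / of_int q = \<xi> - \<alpha>" using q by (simp add: pq(3) field_simps)
    finally show ?thesis unfolding height .
  qed
  with ct show ?thesis by blast
qed

end
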